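(* Let $\mathfrak u$ be a compact semisimple Lie algebra and let $(\pi,V)$ be a finite-dimensional real representation of $\mathfrak u$. Assume $V$ decomposes into $\mathfrak u$-submodules as $V=W_1\oplus\dots\oplus W_k$ such that, for some index $i$, there exist a decomposition $W_i=V_1'\oplus V_2'$ and a real inner product on $W_i$ satisfying properties (1)–(6) listed in the context (applied to the representation of $\mathfrak u$ on $W_i$, with $V_1=V_1'$ and $V_2=V_2'$). Then, for all positive real numbers $c_1,\dots,c_k$, the Lie algebra $(\mathbb R Z\oplus\mathfrak u)\ltimes V$ determined by $\operatorname{ad}Z|_{\mathfrak u}=0$ and $\operatorname{ad}Z|_{W_j}=c_j\operatorname{Id}_{W_j}$ for all $1\le j\le k$ (with $\mathfrak u$ acting on the abelian ideal $V$ by $\pi$) admits an inner product with negative Ricci curvature.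
   Context: A real Lie algebra is compact semisimple if its Killing form is negative definite. $\mathfrak u_{\mathbb C}=\mathfrak u\otimes_{\mathbb R}\mathbb C$, with Killing form $B$, Cartan subalgebra $\mathfrak h$, root system $\Delta$, a fixed positive system $\Delta^+$, and one-dimensional root spaces $(\mathfrak u_{\mathbb C})_\alpha$. For $\alpha\in\Delta$, $H_\alpha\in\mathfrak h$ is defined by $B(H,H_\alpha)=\alpha(H)$ for all $H\in\mathfrak h$; $\mathfrak h_{\mathbb R}$ is the real span of all $H_\alpha$. Root vectors $X_\alpha\in(\mathfrak u_{\mathbb C})_\alpha$ are chosen with $[X_\alpha,X_{-\alpha}]=H_\alpha$; $[X_\alpha,X_\beta]=N_{\alpha,\beta}X_{\alpha+\beta}$ if $\alpha+\beta\in\Delta$, with $N_{\alpha,\beta}=-N_{-\alpha,-\beta}\in\mathbb R$; $[X_\alpha,X_\beta]=0$ if $\alpha+\beta\neq0$ and $\alpha+\beta\notin\Delta$; and such that $\mathfrak u=\sum_{\alpha\in\Delta}\mathbb R\,iH_\alpha+\sum_{\alpha\in\Delta}\mathbb R X^\alpha+\sum_{\alpha\in\Delta}\mathbb R Y^\alpha$, where $X^\alpha=X_\alpha-X_{-\alpha}$ and $Y^\alpha=i(X_\alpha+X_{-\alpha})$ (this is always possible up to isomorphism, by uniqueness of compact real forms). Properties, for a real representation $(\pi,V)$ of $\mathfrak u$ with a decomposition $V=V_1\oplus V_2$ and an inner product $\langle\cdot,\cdot\rangle$ on $V$: (1) $V_1$ and $V_2$ are $i\mathfrak h_{\mathbb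 R}$-invariant. (2) $\pi(X^\alpha)(V_1)\subset V_2$ and $\pi(Y^\alpha)(V_1)\subset V_2$ for every $\alpha\in\Delta^+$. (3) $V_1$ is orthogonal to $V_2$. (4) $\pi(H)$ is a skew-symmetric operator of $V$ for every $H\in i\mathfrak h_{\mathbb R}$. (5) $\pi(X^\alpha)|_{V_1}$ and $\pi(Y^\alpha)|_{V_1}$ are non-zero for every $\alpha\in\Delta^+$. (6) $\operatorname{tr}\big((\pi(Y)|_{V_1})^t\,\pi(X)|_{V_1}\big)=0$ whenever $X\neq Y$ are elements of $\{X^\alpha,Y^\alpha:\alpha\in\Delta^+\}$. An inner product on a real Lie algebra $\mathfrak g$ has negative Ricci curvature if the corresponding left-invariant Riemannian metric on the simply connected Lie group with Lie algebra $\mathfrak g$ has negative definite Ricci operator. *)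

theory Defs
  imports "HOL-Analysis.Analysis" "HOL-Library.Function_Algebras"
begin

definition fin_dim :: "('k::field \<Rightarrow> 'a::ab_group_add \<Rightarrow> 'a) \<Rightarrow> bool" where
  "fin_dim smul \<longleftrightarrow> (\<exists>B. finite B \<and> module.span smul B = UNIV)"

text \<open>Trace of a linear endomorphism of a finite-dimensional subspace \<open>S\<close>, computed in an arbitrarily chosen basis.\<close>

definition trace_on :: "('k::field \<Rightarrow> 'a::ab_group_add \<Rightarrow> 'a) \<Rightarrow> 'a set \<Rightarrow> ('a \<Rightarrow> 'a) \<Rightarrow> 'k" where
  "trace_on smul S f =
     (let B = SOME B. \<not> module.dependent smul B \<and> module.span smul B = S
      in \<Sum>b\<in>B. module.representation smul B (f b) b)"

definition inner_product_on :: "'v::real_vector set \<Rightarrow> ('v \<Rightarrow> 'v \<Rightarrow> real) \<Rightarrow> bool" where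
  "inner_product_on S ip \<longleftrightarrow>
     (\<forall>x\<in>S. \<forall>y\<in>S. ip x y = ip y x) \<and>
     (\<forall>x\<in>S. \<forall>y\<in>S. \<forall>z\<in>S. ip (x + y) z = ip x z + ip y z) \<and>
     (\<forall>a. \<forall>x\<in>S. \<forall>y\<in>S. ip (a *\<^sub>R x) y = a * ip x y) \<and>
     (\<forall>x\<in>S. x \<noteq> 0 \<longrightarrow> ip x x > 0)"

text \<open>The value at \<open>w\<close> of the transpose of \<open>A\<close> restricted to the subspace \<open>S\<close>, a map into \<open>S\<close>.\<close>

definition transpose_on ::
    "('v::real_vector \<Rightarrow> 'v \<Rightarrow> real) \<Rightarrow> 'v set \<Rightarrow> ('v \<Rightarrow> 'v) \<Rightarrow> 'v \<Rightarrow> 'v" where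
  "transpose_on ip S A w = (THE v. v \<in> S \<and> (\<forall>s\<in>S. ip v s = ip w (A s)))"

definition direct_sum_decomposition ::
    "'i set \<Rightarrow> ('i \<Rightarrow> 'v::real_vector set) \<Rightarrow> 'v set \<Rightarrow> bool" where
  "direct_sum_decomposition I W U \<longleftrightarrow>
     (\<forall>j\<in>I. subspace (W j) \<and> W j \<subseteq> U) \<and>
     (\<forall>v\<in>U. \<exists>!w. w \<in> Pi\<^sub>E I W \<and> v = (\<Sum>j\<in>I. w j))"

definition direct_sum2 :: "'v::real_vector set \<Rightarrow> 'v set \<Rightarrow> 'v set \<Rightarrow> bool" where
  "direct_sum2 V1 V2 U \<longleftrightarrow>
     subspace V1 \<and> subspace V2 \<and> V1 \<inter> V2 = {0} \<and> U = {v1 + v2 | v1 v2. v1 \<in> V1 \<and> v2 \<in> V2}"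

locale lie_algebra = vector_space smul
  for smul :: "'k::field \<Rightarrow> 'a::ab_group_add \<Rightarrow> 'a" +
  fixes bracket :: "'a \<Rightarrow> 'a \<Rightarrow> 'a"
  assumes linear_right: "Vector_Spaces.linear smul smul (bracket x)"
    and linear_left: "Vector_Spaces.linear smul smul (\<lambda>x. bracket x y)"
    and bracket_self: "bracket x x = 0"
    and jacobi: "bracket x (bracket y z) + bracket y (bracket z x) + bracket z (bracket x y) = 0"

definition killing_form ::
    "('k::field \<Rightarrow> 'a::ab_group_add \<Rightarrow> 'a) \<Rightarrow> ('a \<Rightarrow> 'a \<Rightarrow> 'a) \<Rightarrow> 'a \<Rightarrow> 'a \<Rightarrow> 'k" where
  "killing_form smul br x y = trace_on smul UNIV (\<lambda>z. br x (br y z))"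

definition compact_semisimple :: "('u::real_vector \<Rightarrow> 'u \<Rightarrow> 'u) \<Rightarrow> bool" where
  "compact_semisimple br \<longleftrightarrow>
     lie_algebra scaleR br \<and> fin_dim (scaleR :: real \<Rightarrow> 'u \<Rightarrow> 'u) \<and>
     (\<forall>x. x \<noteq> 0 \<longrightarrow> killing_form scaleR br x x < 0)"

primrec lower_central ::
    "('k::field \<Rightarrow> 'a::ab_group_add \<Rightarrow> 'a) \<Rightarrow> ('a \<Rightarrow> 'a \<Rightarrow> 'a) \<Rightarrow> 'a set \<Rightarrow> nat \<Rightarrow> 'a set" where
  "lower_central smul br S 0 = S"
| "lower_central smul br S (Suc n) =
     module.span smul {br x y | x y. x \<in> S \<and> y \<in> lower_central smul br S n}"

text \<open>A Cartan subalgebra is a nilpotent subalgebra that is its own normaliser.\<close>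

definition cartan_subalgebra ::
    "('k::field \<Rightarrow> 'a::ab_group_add \<Rightarrow> 'a) \<Rightarrow> ('a \<Rightarrow> 'a \<Rightarrow> 'a) \<Rightarrow> 'a set \<Rightarrow> bool" where
  "cartan_subalgebra smul br h \<longleftrightarrow>
     module.subspace smul h \<and> (\<forall>x\<in>h. \<forall>y\<in>h. br x y \<in> h) \<and>
     (\<exists>n. lower_central smul br h n = {0}) \<and>
     {x. \<forall>y\<in>h. br x y \<in> h} = h"

text \<open>Elements of the dual space of \<open>h\<close> are represented by functions on the whole type that vanish
  outside \<open>h\<close>, so that each functional has one representative and the pointwise operations on
  functions are those of the dual space.\<close>

definition dual_space ::
    "('k::field \<Rightarrow> 'a::ab_group_add \<Rightarrow> 'a) \<Rightarrow> 'a set \<Rightarrow> ('a \<Rightarrow> 'k) set" where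
  "dual_space smul h = {\<alpha>.
     (\<forall>x\<in>h. \<forall>y\<in>h. \<alpha> (x + y) = \<alpha> x + \<alpha> y) \<and>
     (\<forall>c. \<forall>x\<in>h. \<alpha> (smul c x) = c * \<alpha> x) \<and>
     (\<forall>x. x \<notin> h \<longrightarrow> \<alpha> x = 0)}"

definition root_space ::
    "('k::field \<Rightarrow> 'a::ab_group_add \<Rightarrow> 'a) \<Rightarrow> ('a \<Rightarrow> 'a \<Rightarrow> 'a) \<Rightarrow> 'a set \<Rightarrow> ('a \<Rightarrow> 'k) \<Rightarrow> 'a set" where
  "root_space smul br h \<alpha> = {x. \<forall>H\<in>h. br H x = smul (\<alpha> H) x}"

definition roots ::
    "('k::field \<Rightarrow> 'a::ab_group_add \<Rightarrow> 'a) \<Rightarrow> ('a \<Rightarrow> 'a \<Rightarrow> 'a) \<Rightarrow> 'a set \<Rightarrow> ('a \<Rightarrow> 'k) set" where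
  "roots smul br h = {\<alpha> \<in> dual_space smul h. \<alpha> \<noteq> 0 \<and> root_space smul br h \<alpha> \<noteq> {0}}"

definition positive_system :: "('a \<Rightarrow> 'k::field) set \<Rightarrow> ('a \<Rightarrow> 'k) set \<Rightarrow> bool" where
  "positive_system \<Delta> P \<longleftrightarrow>
     P \<subseteq> \<Delta> \<and> (\<forall>\<alpha>\<in>\<Delta>. (\<alpha> \<in> P) \<noteq> (- \<alpha> \<in> P)) \<and>
     (\<forall>\<alpha>\<in>P. \<forall>\<beta>\<in>P. \<alpha> + \<beta> \<in> \<Delta> \<longrightarrow> \<alpha> + \<beta> \<in> P)"

definition lie_representation ::
    "('u::real_vector \<Rightarrow> 'u \<Rightarrow> 'u) \<Rightarrow> ('u \<Rightarrow> 'v::real_vector \<Rightarrow> 'v) \<Rightarrow> bool" where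
  "lie_representation br \<pi> \<longleftrightarrow>
     bilinear \<pi> \<and> (\<forall>x y v. \<pi> (br x y) v = \<pi> x (\<pi> y v) - \<pi> y (\<pi> x v))"

definition submodule :: "('u \<Rightarrow> 'v::real_vector \<Rightarrow> 'v) \<Rightarrow> 'v set \<Rightarrow> bool" where
  "submodule \<pi> S \<longleftrightarrow> subspace S \<and> (\<forall>x. \<pi> x ` S \<subseteq> S)"

text \<open>The complexification of \<open>'u\<close> is \<open>'u \<times> 'u\<close>, where \<open>(x, y)\<close> stands for \<open>x + i y\<close>. The real Lie
  algebra sits inside it as the set of pairs \<open>(x, 0)\<close>, and the real scalar multiplication of the
  product type is the restriction of \<open>cscale\<close>.\<close>

definition cscale :: "complex \<Rightarrow> 'u::real_vector \<times> 'u \<Rightarrow> 'u \<times> 'u" where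
  "cscale c p = (Re c *\<^sub>R fst p - Im c *\<^sub>R snd p, Re c *\<^sub>R snd p + Im c *\<^sub>R fst p)"

definition cbracket ::
    "('u::real_vector \<Rightarrow> 'u \<Rightarrow> 'u) \<Rightarrow> 'u \<times> 'u \<Rightarrow> 'u \<times> 'u \<Rightarrow> 'u \<times> 'u" where
  "cbracket br p q =
     (br (fst p) (fst q) - br (snd p) (snd q), br (fst p) (snd q) + br (snd p) (fst q))"

lemma vector_space_cscale: "vector_space (cscale :: complex \<Rightarrow> 'u::real_vector \<times> 'u \<Rightarrow> 'u \<times> 'u)"
  by unfold_locales (auto simp: cscale_def prod_eq_iff algebra_simps)

lemma cscale_of_real: "cscale (of_real r) p = r *\<^sub>R p"
  by (simp add: cscale_def prod_eq_iff)

lemma lie_algebra_cbracket: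
  assumes "lie_algebra scaleR br"
  shows "lie_algebra cscale (cbracket br)"
proof -
  interpret L: lie_algebra scaleR br by fact
  have R: "linear (br x)" and L: "linear (\<lambda>y. br y x)" for x
    using L.linear_right[of x] L.linear_left[of x] by (simp_all add: Real_Vector_Spaces.linear_def)
  note simps = linear_add[OF R] linear_diff[OF R] linear_scale[OF R]
    linear_add[OF L] linear_diff[OF L] linear_scale[OF L] L.bracket_self
  have anti: "br y x = - br x y" for x y
    using L.bracket_self[of "x + y"] L.bracket_self[of x] L.bracket_self[of y]
    by (metis linear_add[OF L] linear_add[OF R] add.left_neutral add.right_neutral
        eq_neg_iff_add_eq_0)
  have jac: "br z (br x y) = - br x (br y z) - br y (br z x)" for x y z
    using L.jacobi[of x y z] by (simp add: algebra_simps eq_neg_iff_add_eq_0)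
  interpret C: vector_space "cscale :: complex \<Rightarrow> 'a \<times> 'a \<Rightarrow> 'a \<times> 'a"
    by (rule vector_space_cscale)
  show ?thesis
  proof (intro lie_algebra.intro lie_algebra_axioms.intro vector_space_cscale)
    fix p q s :: "'a \<times> 'a"
    show "Vector_Spaces.linear cscale cscale (cbracket br p)"
      by unfold_locales (auto simp: cbracket_def cscale_def simps algebra_simps)
    show "Vector_Spaces.linear cscale cscale (\<lambda>p. cbracket br p q)"
      by unfold_locales (auto simp: cbracket_def cscale_def simps algebra_simps)
    show "cbracket br p p = 0"
      using anti[of "fst p" "snd p"] by (simp add: cbracket_def simps prod_eq_iff)
    show "cbracket br p (cbracket br q s) + cbracket br q (cbracket br s p)
        + cbracket br s (cbracket br p q) = 0"
      by (simp add: cbracket_def prod_eq_iff simps jac[of "fst s"] jac[of "snd s"] algebra_simps)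
  qed
qed

abbreviation croots :: "('u::real_vector \<Rightarrow> 'u \<Rightarrow> 'u) \<Rightarrow> ('u \<times> 'u) set \<Rightarrow> ('u \<times> 'u \<Rightarrow> complex) set" where
  "croots br h \<equiv> roots cscale (cbracket br) h"

definition Xup :: "(('u \<times> 'u \<Rightarrow> complex) \<Rightarrow> 'u \<times> 'u) \<Rightarrow> ('u \<times> 'u \<Rightarrow> complex) \<Rightarrow> 'u::real_vector \<times> 'u" where
  "Xup X \<alpha> = X \<alpha> - X (- \<alpha>)"

definition Yup :: "(('u \<times> 'u \<Rightarrow> complex) \<Rightarrow> 'u \<times> 'u) \<Rightarrow> ('u \<times> 'u \<Rightarrow> complex) \<Rightarrow> 'u::real_vector \<times> 'u" where
  "Yup X \<alpha> = cscale \<i> (X \<alpha> + X (- \<alpha>))"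

text \<open>The choices \<open>H\<close>, \<open>X\<close>, \<open>N\<close> only matter on roots. The last conjunct identifies the compact real
  form with the real span of all \<open>i H\<^sub>\<alpha>\<close>, \<open>X\<^sup>\<alpha>\<close>, \<open>Y\<^sup>\<alpha>\<close>.\<close>

definition adapted_root_vectors ::
    "('u::real_vector \<Rightarrow> 'u \<Rightarrow> 'u) \<Rightarrow> ('u \<times> 'u) set \<Rightarrow>
     (('u \<times> 'u \<Rightarrow> complex) \<Rightarrow> 'u \<times> 'u) \<Rightarrow> (('u \<times> 'u \<Rightarrow> complex) \<Rightarrow> 'u \<times> 'u) \<Rightarrow>
     (('u \<times> 'u \<Rightarrow> complex) \<Rightarrow> ('u \<times> 'u \<Rightarrow> complex) \<Rightarrow> real) \<Rightarrow> bool" where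
  "adapted_root_vectors br h H X N \<longleftrightarrow>
     (let \<Delta> = croots br h; cbr = cbracket br in
       (\<forall>\<alpha>\<in>\<Delta>. H \<alpha> \<in> h \<and> (\<forall>T\<in>h. killing_form cscale cbr T (H \<alpha>) = \<alpha> T)) \<and>
       (\<forall>\<alpha>\<in>\<Delta>. X \<alpha> \<in> root_space cscale cbr h \<alpha>) \<and>
       (\<forall>\<alpha>\<in>\<Delta>. cbr (X \<alpha>) (X (- \<alpha>)) = H \<alpha>) \<and>
       (\<forall>\<alpha>\<in>\<Delta>. \<forall>\<beta>\<in>\<Delta>. \<alpha> + \<beta> \<in> \<Delta> \<longrightarrow>
          cbr (X \<alpha>) (X \<beta>) = N \<alpha> \<beta> *\<^sub>R X (\<alpha> + \<beta>) \<and> N \<alpha> \<beta> = - N (- \<alpha>) (- \<beta>)) \<and>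
       (\<forall>\<alpha>\<in>\<Delta>. \<forall>\<beta>\<in>\<Delta>. \<alpha> + \<beta> \<noteq> 0 \<longrightarrow> \<alpha> + \<beta> \<notin> \<Delta> \<longrightarrow> cbr (X \<alpha>) (X \<beta>) = 0) \<and>
       range (\<lambda>x. (x, 0)) = span ((\<lambda>\<alpha>. cscale \<i> (H \<alpha>)) ` \<Delta> \<union> Xup X ` \<Delta> \<union> Yup X ` \<Delta>))"

text \<open>Under \<open>adapted_root_vectors\<close> the elements \<open>X\<^sup>\<alpha>\<close>, \<open>Y\<^sup>\<alpha>\<close> and the space \<open>i h\<^sub>\<real>\<close> lie in the real
  form, so \<open>fst\<close> turns them into elements of \<open>'u\<close>.\<close>

definition Xu :: "(('u \<times> 'u \<Rightarrow> complex) \<Rightarrow> 'u \<times> 'u) \<Rightarrow> ('u \<times> 'u \<Rightarrow> complex) \<Rightarrow> 'u::real_vector" where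
  "Xu X \<alpha> = fst (Xup X \<alpha>)"

definition Yu :: "(('u \<times> 'u \<Rightarrow> complex) \<Rightarrow> 'u \<times> 'u) \<Rightarrow> ('u \<times> 'u \<Rightarrow> complex) \<Rightarrow> 'u::real_vector" where
  "Yu X \<alpha> = fst (Yup X \<alpha>)"

definition ihR ::
    "(('u \<times> 'u \<Rightarrow> complex) \<Rightarrow> 'u \<times> 'u) \<Rightarrow> ('u \<times> 'u \<Rightarrow> complex) set \<Rightarrow> 'u::real_vector set" where
  "ihR H \<Delta> = fst ` cscale \<i> ` span (H ` \<Delta>)"

definition splitting_properties ::
    "(('u::real_vector \<times> 'u \<Rightarrow> complex) \<Rightarrow> 'u \<times> 'u) \<Rightarrow> (('u \<times> 'u \<Rightarrow> complex) \<Rightarrow> 'u \<times> 'u) \<Rightarrow>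
     ('u \<times> 'u \<Rightarrow> complex) set \<Rightarrow> ('u \<times> 'u \<Rightarrow> complex) set \<Rightarrow> ('u \<Rightarrow> 'v::real_vector \<Rightarrow> 'v) \<Rightarrow>
     'v set \<Rightarrow> 'v set \<Rightarrow> 'v set \<Rightarrow> ('v \<Rightarrow> 'v \<Rightarrow> real) \<Rightarrow> bool" where
  "splitting_properties H X \<Delta> P \<pi> W V1 V2 ip \<longleftrightarrow>
     (\<forall>T\<in>ihR H \<Delta>. \<pi> T ` V1 \<subseteq> V1 \<and> \<pi> T ` V2 \<subseteq> V2) \<and>
     (\<forall>\<alpha>\<in>P. \<pi> (Xu X \<alpha>) ` V1 \<subseteq> V2 \<and> \<pi> (Yu X \<alpha>) ` V1 \<subseteq> V2) \<and>
     (\<forall>v\<in>V1. \<forall>w\<in>V2. ip v w = 0) \<and>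
     (\<forall>T\<in>ihR H \<Delta>. \<forall>v\<in>W. \<forall>w\<in>W. ip (\<pi> T v) w = - ip v (\<pi> T w)) \<and>
     (\<forall>\<alpha>\<in>P. (\<exists>v\<in>V1. \<pi> (Xu X \<alpha>) v \<noteq> 0) \<and> (\<exists>v\<in>V1. \<pi> (Yu X \<alpha>) v \<noteq> 0)) \<and>
     (\<forall>x\<in>Xu X ` P \<union> Yu X ` P. \<forall>y\<in>Xu X ` P \<union> Yu X ` P. x \<noteq> y \<longrightarrow>
        trace_on scaleR V1 (\<lambda>v. transpose_on ip V1 (\<pi> y) (\<pi> x v)) = 0)"

text \<open>For a left-invariant metric on a Lie group with Lie algebra \<open>'g\<close>, the Levi-Civita connection maps
  left-invariant fields to left-invariant fields, and inner products of left-invariant fields are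
  constant. On left-invariant fields it is therefore the unique bilinear map that is torsion-free
  and skew-symmetric with respect to the inner product; curvature is computed from it.\<close>

definition levi_civita ::
    "('g::real_vector \<Rightarrow> 'g \<Rightarrow> 'g) \<Rightarrow> ('g \<Rightarrow> 'g \<Rightarrow> real) \<Rightarrow> 'g \<Rightarrow> 'g \<Rightarrow> 'g" where
  "levi_civita br ip = (THE D. bilinear D \<and>
     (\<forall>x y. D x y - D y x = br x y) \<and>
     (\<forall>x y z. ip (D x y) z + ip y (D x z) = 0))"

definition curvature ::
    "('g::real_vector \<Rightarrow> 'g \<Rightarrow> 'g) \<Rightarrow> ('g \<Rightarrow> 'g \<Rightarrow> real) \<Rightarrow> 'g \<Rightarrow> 'g \<Rightarrow> 'g \<Rightarrow> 'g" where
  "curvature br ip x y z =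
     (let D = levi_civita br ip in D x (D y z) - D y (D x z) - D (br x y) z)"

definition ricci_tensor ::
    "('g::real_vector \<Rightarrow> 'g \<Rightarrow> 'g) \<Rightarrow> ('g \<Rightarrow> 'g \<Rightarrow> real) \<Rightarrow> 'g \<Rightarrow> 'g \<Rightarrow> real" where
  "ricci_tensor br ip x y = trace_on scaleR UNIV (\<lambda>z. curvature br ip z x y)"

definition ricci_operator ::
    "('g::real_vector \<Rightarrow> 'g \<Rightarrow> 'g) \<Rightarrow> ('g \<Rightarrow> 'g \<Rightarrow> real) \<Rightarrow> 'g \<Rightarrow> 'g" where
  "ricci_operator br ip x = (THE w. \<forall>y. ip w y = ricci_tensor br ip x y)"

definition negative_ricci :: "('g::real_vector \<Rightarrow> 'g \<Rightarrow> 'g) \<Rightarrow> ('g \<Rightarrow> 'g \<Rightarrow> real) \<Rightarrow> bool" where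
  "negative_ricci br ip \<longleftrightarrow> (\<forall>x. x \<noteq> 0 \<longrightarrow> ip (ricci_operator br ip x) x < 0)"

text \<open>The triple \<open>((a, x), v)\<close> stands for \<open>a Z + x + v\<close>; the endomorphism \<open>D\<close> is \<open>ad Z\<close> on \<open>V\<close>.\<close>

definition semidirect_bracket ::
    "('u::real_vector \<Rightarrow> 'u \<Rightarrow> 'u) \<Rightarrow> ('u \<Rightarrow> 'v::real_vector \<Rightarrow> 'v) \<Rightarrow> ('v \<Rightarrow> 'v) \<Rightarrow>
     (real \<times> 'u) \<times> 'v \<Rightarrow> (real \<times> 'u) \<times> 'v \<Rightarrow> (real \<times> 'u) \<times> 'v" where
  "semidirect_bracket br \<pi> D = (\<lambda>((a, x), v) ((b, y), w).
     ((0, br x y), (a *\<^sub>R D w + \<pi> x w) - (b *\<^sub>R D v + \<pi> y v)))"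

lemma lie_algebra_semidirect_bracket:
  assumes "lie_algebra scaleR br" "lie_representation br \<pi>" and D: "linear D"
    and comm: "\<And>x v. D (\<pi> x v) = \<pi> x (D v)"
  shows "lie_algebra scaleR (semidirect_bracket br \<pi> D)"
proof -
  interpret L: lie_algebra scaleR br by fact
  have R: "linear (br x)" and L: "linear (\<lambda>y. br y x)" for x
    using L.linear_right[of x] L.linear_left[of x] by (simp_all add: Real_Vector_Spaces.linear_def)
  have R': "linear (\<pi> x)" and L': "linear (\<lambda>y. \<pi> y v)" for x v
    using assms(2) by (simp_all add: lie_representation_def bilinear_def)
  have rep: "\<pi> (br x y) v = \<pi> x (\<pi> y v) - \<pi> y (\<pi> x v)" for x y v
    using assms(2) by (simp add: lie_representation_def)
  note simps = linear_add[OF R] linear_diff[OF R] linear_scale[OF R]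
    linear_add[OF L] linear_diff[OF L] linear_scale[OF L] L.bracket_self
    linear_add[OF R'] linear_diff[OF R'] linear_scale[OF R']
    linear_add[OF L'] linear_diff[OF L'] linear_scale[OF L']
    linear_add[OF D] linear_diff[OF D] linear_scale[OF D] rep comm
    L.jacobi[unfolded add.assoc]
  show ?thesis
    by unfold_locales
      (auto simp: semidirect_bracket_def split_beta prod_eq_iff simps algebra_simps
        intro!: linearI)
qed

end

theory Submission
  imports Defs
begin

text \<open>
The inner product on \<open>\<real>Z \<oplus> \<uu> \<oplus> V\<close> is chosen with the three summands orthogonal, with
\<open>\<uu>\<close> scaled up by a large factor, and with the submodules \<open>W\<^sub>j\<close> mutually orthogonal, so that
\<open>D\<close> is diagonal with positive eigenvalues in an orthonormal basis of \<open>V\<close>. Every \<open>ad x\<close>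
with \<open>x \<in> \<uu>\<close> and every \<open>D \<circ> \<pi>(x)\<close> is traceless, since \<open>\<uu>\<close> is perfect, and this makes the
Ricci form block diagonal (\<open>ricci_semidirect\<close>):

\<^item> on \<open>Z\<close> it is \<open>- tr D\<^sup>2 < 0\<close>;

\<^item> on \<open>V\<close> it is \<open>- (tr D) \<langle>D v, v\<rangle>\<close> plus terms in \<open>\<pi>\<close> that are divided by the scale of \<open>\<uu>\<close>
  and hence negligible (\<open>negative_ricci_after_scaling\<close>);

\<^item> on \<open>\<uu>\<close> it does not depend on the scale and is \<open>Ric\<^sub>\<uu>(x, x) - \<bar>S(\<pi>(x))\<bar>\<^sup>2\<close>, where \<open>S\<close> is the
  symmetric part.

It remains to make the block on \<open>\<uu>\<close> negative. Let \<open>\<tt> = i \<hh>\<^sub>\<real>\<close>.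

In the direction of \<open>\<tt>\<close> a metric on \<open>\<uu>\<close> that is not \<open>ad \<tt>\<close>-invariant does the job. If the vectors of a
Killing-orthonormal basis of \<open>\<tt>\<^sup>\<bottom>\<close> are given distinct positive integers as lengths and a
Killing-orthonormal basis of \<open>\<tt>\<close> keeps length one, then \<open>ad x\<close> is not skew for
\<open>0 \<noteq> x \<in> \<tt>\<close>, and the negative term \<open>- \<bar>S(ad x)\<bar>\<^sup>2\<close> outweighs the positive one (\<open>abelian_metric\<close>).

Transversally to \<open>\<tt>\<close> the representation on \<open>W\<^sub>i = V\<^sub>1 \<oplus> V\<^sub>2\<close> does the job. Stretching \<open>V\<^sub>2\<close> by a factor \<open>t\<close>
multiplies the block \<open>V\<^sub>1 \<rightarrow> V\<^sub>2\<close> of \<open>\<pi>(x)\<close> by \<open>t\<close>, so that \<open>- \<bar>S(\<pi>(x))\<bar>\<^sup>2\<close> is at most \<open>- t\<^sup>2 Q(x, x) / 2\<close>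
plus a term independent of \<open>t\<close> that vanishes on \<open>\<tt>\<close>, where \<open>Q(x, x)\<close> is the squared norm of that block
for \<open>t = 1\<close>. The properties of the splitting say that the null space of \<open>Q\<close> is contained in \<open>\<tt>\<close>
(\<open>off_diagonal_block_kernel\<close>), because \<open>\<uu>\<close> is the sum of \<open>\<tt>\<close> and the span of all \<open>X\<^sup>\<alpha>\<close>, \<open>Y\<^sup>\<alpha>\<close>
(\<open>real_form_decomposition\<close>). A form that is negative on the null space of \<open>Q\<close> becomes negative definite
after a large multiple of \<open>Q\<close> is subtracted (\<open>negative_definite_after_penalty\<close>), so a large \<open>t\<close> suffices.
\<close>

section \<open>Bilinear forms and inner products on abstract finite-dimensional spaces\<close>

lemma bilinear_product:
  fixes \<phi> \<psi> :: "'a::real_vector \<Rightarrow> real"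
  shows "linear \<phi> \<Longrightarrow> linear \<psi> \<Longrightarrow> bilinear (\<lambda>x y. \<phi> x * \<psi> y)"
  unfolding bilinear_def
  by (auto intro!: linearI simp: linear_add linear_scale algebra_simps)

lemma bilinear_sum_fun:
  fixes f :: "'i \<Rightarrow> 'a::real_vector \<Rightarrow> 'a \<Rightarrow> real"
  assumes "\<And>i. i \<in> A \<Longrightarrow> bilinear (f i)"
  shows "bilinear (\<lambda>x y. \<Sum>i\<in>A. f i x y)"
  unfolding bilinear_def
  using assms
  by (auto intro!: linearI simp: bilinear_ladd bilinear_radd bilinear_lmul bilinear_rmul
      sum.distrib sum_distrib_left)

lemma bilinear_diff_fun:
  fixes f g :: "'a::real_vector \<Rightarrow> 'a \<Rightarrow> real"
  assumes "bilinear f" "bilinear g"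
  shows "bilinear (\<lambda>x y. f x y - g x y)"
  unfolding bilinear_def
  by (intro conjI allI linearI)
    (simp_all add: bilinear_ladd[OF assms(1)] bilinear_radd[OF assms(1)] bilinear_lmul[OF assms(1)]
      bilinear_rmul[OF assms(1)] bilinear_ladd[OF assms(2)] bilinear_radd[OF assms(2)]
      bilinear_lmul[OF assms(2)] bilinear_rmul[OF assms(2)] algebra_simps)

lemma bilinear_divide_fun:
  fixes f :: "'a::real_vector \<Rightarrow> 'a \<Rightarrow> real"
  assumes "bilinear f"
  shows "bilinear (\<lambda>x y. f x y / c)"
  unfolding bilinear_def
  by (intro conjI allI linearI)
    (simp_all add: bilinear_ladd[OF assms] bilinear_radd[OF assms] bilinear_lmul[OF assms]
      bilinear_rmul[OF assms] add_divide_distrib)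

lemma linear_bilinear_right: "bilinear f \<Longrightarrow> linear (f x)"
  and linear_bilinear_left: "bilinear f \<Longrightarrow> linear (\<lambda>x. f x y)"
  by (simp_all add: bilinear_def)

definition orthonormal :: "'a::real_vector set \<Rightarrow> ('a \<Rightarrow> 'a \<Rightarrow> real) \<Rightarrow> 'a set \<Rightarrow> bool" where
  "orthonormal S ip E \<longleftrightarrow> finite E \<and> E \<subseteq> S \<and> (\<forall>x\<in>E. \<forall>y\<in>E. ip x y = (if x = y then 1 else 0))"

context
  fixes S :: "'a::real_vector set" and ip :: "'a \<Rightarrow> 'a \<Rightarrow> real"
  assumes S: "subspace S" and ip: "inner_product_on S ip"
begin

lemma ip_commute: "x \<in> S \<Longrightarrow> y \<in> S \<Longrightarrow> ip x y = ip y x"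
  and ip_add: "x \<in> S \<Longrightarrow> y \<in> S \<Longrightarrow> z \<in> S \<Longrightarrow> ip (x + y) z = ip x z + ip y z"
  and ip_scale: "x \<in> S \<Longrightarrow> y \<in> S \<Longrightarrow> ip (a *\<^sub>R x) y = a * ip x y"
  and ip_pos: "x \<in> S \<Longrightarrow> x \<noteq> 0 \<Longrightarrow> ip x x > 0"
  using ip by (simp_all add: inner_product_on_def)

lemma ip_zero: "y \<in> S \<Longrightarrow> ip 0 y = 0"
  using ip_scale[of 0 y 0] S by (simp add: subspace_0)

lemma ip_sum:
  "finite A \<Longrightarrow> (\<And>a. a \<in> A \<Longrightarrow> g a \<in> S) \<Longrightarrow> y \<in> S \<Longrightarrow> ip (\<Sum>a\<in>A. g a) y = (\<Sum>a\<in>A. ip (g a) y)"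
  by (induction A rule: finite_induct) (auto simp: ip_zero ip_add subspace_sum[OF S])

lemma ip_sum_orthonormal:
  assumes "orthonormal S ip E" "f \<in> E"
  shows "ip (\<Sum>b\<in>E. a b *\<^sub>R b) f = a f"
proof -
  have "ip (\<Sum>b\<in>E. a b *\<^sub>R b) f = (\<Sum>b\<in>E. a b * ip b f)"
    using assms by (subst ip_sum) (auto simp: orthonormal_def subset_iff subspace_scale[OF S] ip_scale)
  also have "\<dots> = (\<Sum>b\<in>E. if b = f then a b else 0)"
    using assms by (intro sum.cong refl) (auto simp: orthonormal_def)
  also have "\<dots> = a f"
    using assms by (simp add: orthonormal_def)
  finally show ?thesis .
qed

lemma span_orthonormal_coords:
  assumes E: "orthonormal S ip E" and x: "x \<in> span E"
  shows "(\<Sum>b\<in>E. ip x b *\<^sub>R b) = x"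
proof -
  obtain a where a: "x = (\<Sum>b\<in>E. a b *\<^sub>R b)"
    using x E by (auto simp: orthonormal_def span_finite)
  have "ip x b = a b" if "b \<in> E" for b
    unfolding a by (rule ip_sum_orthonormal[OF E that])
  then show ?thesis unfolding a by (intro sum.cong refl) simp
qed

lemma independent_orthonormal:
  assumes E: "orthonormal S ip E" shows "\<not> dependent E"
proof -
  have "finite E" using E by (simp add: orthonormal_def)
  moreover have "a b = 0" if "(\<Sum>b\<in>E. a b *\<^sub>R b) = 0" "b \<in> E" for a b
    using ip_sum_orthonormal[OF E that(2), of a] that E ip_zero[of b]
    by (simp add: orthonormal_def subset_iff)
  ultimately show ?thesis by (auto simp: dependent_finite)
qed

text \<open>Gram--Schmidt, in the form that keeps an orthonormal set already given, so that a basis of a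
subspace can be continued to one of the whole space.\<close>

lemma orthonormal_extend:
  assumes "orthonormal S ip E0" "finite B" "B \<subseteq> S"
  shows "\<exists>E. E0 \<subseteq> E \<and> orthonormal S ip E \<and> span E = span (E0 \<union> B)"
  using assms(2,3)
proof (induction B)
  case empty
  then show ?case using assms(1) by auto
next
  case (insert b B)
  then obtain E where E: "E0 \<subseteq> E" "orthonormal S ip E" "span E = span (E0 \<union> B)" by auto
  have finE: "finite E" and ES: "E \<subseteq> S" using E by (auto simp: orthonormal_def)
  define p where "p = (\<Sum>f\<in>E. ip b f *\<^sub>R f)"
  define q where "q = b - p"
  have bS: "b \<in> S" using insert by auto
  have pS: "p \<in> S" unfolding p_def using ES by (intro subspace_sum[OF S] subspace_scale[OF S]) auto
  have qS: "q \<in> S" unfolding q_def by (rule subspace_diff[OF S bS pS])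
  have p_span: "p \<in> span E" unfolding p_def by (intro span_sum span_scale span_base)
  have spanb: "span (E0 \<union> insert b B) = span (insert q E)"
  proof -
    have "span (E0 \<union> insert b B) = span (insert b (E0 \<union> B))" by simp
    also have "\<dots> = span (insert b E)" by (simp only: span_insert E(3))
    also have "\<dots> = span (insert q E)"
    proof (rule span_eq[THEN iffD2], intro conjI subsetI)
      fix x assume "x \<in> insert b E"
      have "q + p \<in> span (insert q E)"
        using p_span span_mono[of E "insert q E"] by (intro span_add[OF span_base]) auto
      then show "x \<in> span (insert q E)" using \<open>x \<in> insert b E\<close> span_base[of x "insert q E"] by (auto simp: q_def)
    next
      fix x assume "x \<in> insert q E"
      have "b - p \<in> span (insert b E)"
        using p_span span_mono[of E "insert b E"] by (intro span_diff[OF span_base]) auto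
      then show "x \<in> span (insert b E)" using \<open>x \<in> insert q E\<close> span_base[of x "insert b E"] by (auto simp: q_def)
    qed
    finally show ?thesis .
  qed
  show ?case
  proof (cases "q = 0")
    case True
    then have "span (E0 \<union> insert b B) = span E" unfolding spanb by (simp add: span_insert_0)
    then show ?thesis using E by auto
  next
    case False
    define n where "n = sqrt (ip q q)"
    have n: "n > 0" "n * n = ip q q" unfolding n_def using ip_pos[OF qS False] by simp_all
    define u where "u = (1 / n) *\<^sub>R q"
    have uS: "u \<in> S" unfolding u_def by (rule subspace_scale[OF S qS])
    have qf: "ip q f = 0" if f: "f \<in> E" for f
    proof -
      have fS: "f \<in> S" using f ES by auto
      have "ip b f = ip (q + p) f" by (simp add: q_def)
      also have "\<dots> = ip q f + ip p f" by (rule ip_add[OF qS pS fS])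
      also have "ip p f = ip b f" unfolding p_def by (rule ip_sum_orthonormal[OF E(2) f])
      finally show ?thesis by simp
    qed
    have uf: "ip u f = 0" "ip f u = 0" if f: "f \<in> E" for f
      using qf[OF f] ip_commute[OF uS, of f] f ES by (auto simp: u_def ip_scale qS subset_iff)
    have uu: "ip u u = 1"
      using n(1) ip_commute[OF qS uS]
      by (simp add: u_def ip_scale qS uS subspace_scale[OF S] flip: n(2))
    have "orthonormal S ip (insert u E)"
      using E(2) uf uu uS by (auto simp: orthonormal_def)
    moreover have "span (insert u E) = span (insert q E)"
    proof (rule span_eq[THEN iffD2], intro conjI subsetI)
      fix x assume "x \<in> insert u E"
      moreover have "u \<in> span (insert q E)" unfolding u_def by (intro span_scale span_base) auto
      ultimately show "x \<in> span (insert q E)" using span_base[of x "insert q E"] by auto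
    next
      fix x assume "x \<in> insert q E"
      moreover have "q = n *\<^sub>R u" using n by (simp add: u_def)
      then have "q \<in> span (insert u E)" by (simp add: span_scale span_base)
      ultimately show "x \<in> span (insert u E)" using span_base[of x "insert u E"] by auto
    qed
    ultimately show ?thesis using E(1) spanb by (intro exI[of _ "insert u E"]) auto
  qed
qed

end

lemma inner_product_on_subset:
  assumes "inner_product_on W ip" "V \<subseteq> W" shows "inner_product_on V ip"
  unfolding inner_product_on_def
proof (intro conjI ballI allI impI)
  fix x y assume "x \<in> V" "y \<in> V"
  then show "ip x y = ip y x" using assms unfolding inner_product_on_def by (meson subsetD)
qed (use assms in \<open>auto simp: inner_product_on_def subset_iff\<close>)

lemma orthonormal_Un:
  assumes W: "subspace W" "inner_product_on W ip" and VW: "V1 \<subseteq> W" "V2 \<subseteq> W"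
    and E: "orthonormal V1 ip E1" "orthonormal V2 ip E2"
    and orth: "\<And>v w. v \<in> V1 \<Longrightarrow> w \<in> V2 \<Longrightarrow> ip v w = 0"
  shows "orthonormal W ip (E1 \<union> E2)"
proof -
  have EV: "E1 \<subseteq> V1" "E2 \<subseteq> V2" using E by (auto simp: orthonormal_def)
  have mixed: "ip x y = (if x = y then 1 else 0)" "ip y x = (if x = y then 1 else 0)"
    if "x \<in> E1" "y \<in> E2" for x y
  proof -
    have xy: "x \<in> V1" "y \<in> V2" using that EV by auto
    have "ip x x = 1" using that E by (simp add: orthonormal_def)
    then have "x \<noteq> y" using orth[of x y] xy by auto
    then show "ip x y = (if x = y then 1 else 0)" using orth[OF xy] by simp
    moreover have "ip y x = ip x y" by (rule ip_commute[OF W]) (use xy VW in auto)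
    ultimately show "ip y x = (if x = y then 1 else 0)" by simp
  qed
  show ?thesis
    unfolding orthonormal_def
  proof (intro conjI ballI)
    fix x y assume "x \<in> E1 \<union> E2" "y \<in> E1 \<union> E2"
    then show "ip x y = (if x = y then 1 else 0)"
      using mixed[of x y] mixed[of y x] E by (auto simp: orthonormal_def)
  qed (use E EV VW in \<open>auto simp: orthonormal_def\<close>)
qed

lemma independent_finite_fin_dim:
  fixes B :: "'a::real_vector set"
  assumes "fin_dim (scaleR :: real \<Rightarrow> 'a \<Rightarrow> 'a)" "\<not> dependent B"
  shows "finite B"
proof -
  obtain B' :: "'a set" where B': "finite B'" "span B' = UNIV"
    using assms(1) unfolding fin_dim_def span_raw_def by blast
  show ?thesis using independent_span_bound[OF B'(1) assms(2)] B'(2) by auto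
qed

lemma subspace_basis:
  fixes S :: "'a::real_vector set"
  assumes "fin_dim (scaleR :: real \<Rightarrow> 'a \<Rightarrow> 'a)" "subspace S"
  obtains B where "finite B" "\<not> dependent B" "span B = S"
proof -
  obtain B where B: "B \<subseteq> S" "\<not> dependent B" "S \<subseteq> span B"
    using maximal_independent_subset[of S] by blast
  show ?thesis
    by (rule that[OF independent_finite_fin_dim[OF assms(1) B(2)] B(2)])
      (metis B(1,3) assms(2) span_subspace)
qed

lemma orthonormal_basis:
  fixes S :: "'a::real_vector set"
  assumes "fin_dim (scaleR :: real \<Rightarrow> 'a \<Rightarrow> 'a)" "subspace S" "inner_product_on S ip"
  obtains E where "orthonormal S ip E" "span E = S"
proof -
  obtain B where B: "finite B" "\<not> dependent B" "span B = S"
    by (rule subspace_basis[OF assms(1,2)])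
  have BS: "B \<subseteq> S" using B(3) span_superset by blast
  have "orthonormal S ip {}" by (simp add: orthonormal_def)
  from orthonormal_extend[OF assms(2,3) this B(1) BS]
  obtain E where "orthonormal S ip E" "span E = span ({} \<union> B)" by blast
  then show ?thesis using that B(3) by simp
qed

text \<open>Let \<open>N\<close> be the null space of \<open>Q\<close>; it is the radical of \<open>Q\<close> by Cauchy--Schwarz. The symmetric
part of \<open>- G\<close> is an inner product on \<open>N\<close>, so every vector splits into a component in \<open>N\<close> and one in the
\<open>G\<close>-orthogonal complement \<open>C\<close> of \<open>N\<close>, without mixed terms for either form. On \<open>C\<close> the form \<open>Q\<close> is positive
definite, and \<open>G\<close> is bounded there by a multiple of \<open>Q\<close>.\<close>

lemma negative_definite_after_penalty:
  fixes G Q :: "'a::real_vector \<Rightarrow> 'a \<Rightarrow> real"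
  assumes fin: "fin_dim (scaleR :: real \<Rightarrow> 'a \<Rightarrow> 'a)"
    and G: "bilinear G" and Q: "bilinear Q"
    and sym: "\<And>x y. Q x y = Q y x" and psd: "\<And>x. Q x x \<ge> 0"
    and neg: "\<And>x. x \<noteq> 0 \<Longrightarrow> Q x x = 0 \<Longrightarrow> G x x < 0"
  obtains l :: real where "\<And>t x. t \<ge> l \<Longrightarrow> x \<noteq> 0 \<Longrightarrow> G x x - t * Q x x < 0"
proof -
  note gs = bilinear_ladd[OF G] bilinear_radd[OF G] bilinear_lmul[OF G] bilinear_rmul[OF G]
    bilinear_lsub[OF G] bilinear_rsub[OF G] bilinear_lzero[OF G] bilinear_rzero[OF G]
  note qs = bilinear_ladd[OF Q] bilinear_radd[OF Q] bilinear_lmul[OF Q] bilinear_rmul[OF Q]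
    bilinear_lsub[OF Q] bilinear_rsub[OF Q] bilinear_lzero[OF Q] bilinear_rzero[OF Q]
  define N where "N = {x. \<forall>y. Q x y = 0}"
  define g where "g x y = - (G x y + G y x) / 2" for x y
  define C where "C = {x. \<forall>b\<in>N. g x b = 0}"
  have N: "x \<in> N" if "Q x x = 0" for x
    unfolding N_def
  proof (rule, rule, rule ccontr)
    fix y assume nz: "Q x y \<noteq> 0"
    \<comment> \<open>With this \<open>s\<close>, and \<open>Q x x = 0\<close>, the value of \<open>Q\<close> at \<open>y + s x\<close> is \<open>-1\<close>.\<close>
    define s where "s = - (Q y y + 1) / (2 * Q x y)"
    have "0 \<le> Q (y + s *\<^sub>R x) (y + s *\<^sub>R x)" by (rule psd)
    also have "\<dots> = Q y y + 2 * s * Q x y"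
      using that sym[of y x] by (simp add: qs algebra_simps)
    also have "\<dots> = - 1" using nz by (simp add: s_def field_simps)
    finally show False by simp
  qed
  have subN: "subspace N" unfolding N_def subspace_def by (auto simp: qs)
  have ipN: "inner_product_on N g"
    unfolding inner_product_on_def
  proof (intro conjI ballI allI impI)
    fix x assume "x \<in> N" "x \<noteq> 0"
    then show "0 < g x x" using neg[of x] by (simp add: N_def g_def)
  qed (simp_all add: g_def gs field_simps)
  have g_left: "g (x + y) z = g x z + g y z" "g (c *\<^sub>R x) z = c * g x z" "g 0 z = 0" for x y z c
    by (simp_all add: g_def gs field_simps)
  have subC: "subspace C" unfolding C_def subspace_def by (simp add: g_left)
  have ipC: "inner_product_on C Q"
    unfolding inner_product_on_def
  proof (intro conjI ballI allI impI)
    fix x assume x: "x \<in> C" "x \<noteq> 0"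
    have "Q x x \<noteq> 0"
    proof
      assume "Q x x = 0"
      then have "x \<in> N" by (rule N)
      then have "g x x = 0" "g x x > 0"
        using x ip_pos[OF subN ipN, of x] by (auto simp: C_def)
      then show False by simp
    qed
    then show "0 < Q x x" using psd[of x] by simp
  qed (auto simp: qs intro: sym)
  obtain E where E: "orthonormal N g E" "span E = N"
    by (rule orthonormal_basis[OF fin subN ipN])
  obtain F where F: "orthonormal C Q F" "span F = C"
    by (rule orthonormal_basis[OF fin subC ipC])
  have finF: "finite F" using F by (simp add: orthonormal_def)
  define M where "M = (\<Sum>i\<in>F. \<Sum>j\<in>F. \<bar>G i j\<bar>)"
  have bound: "G r r \<le> M * Q r r" if r: "r \<in> C" for r
  proof -
    define q where "q b = Q r b" for b
    have rq: "r = (\<Sum>b\<in>F. q b *\<^sub>R b)"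
      using span_orthonormal_coords[OF subC ipC F(1)] F(2) r by (simp add: q_def)
    have l: "G r y = (\<Sum>i\<in>F. q i * G i y)" for y
      by (subst rq) (simp add: linear_sum[OF linear_bilinear_left[OF G]] gs)
    have l2: "G i r = (\<Sum>j\<in>F. q j * G i j)" for i
      by (subst rq) (simp add: linear_sum[OF linear_bilinear_right[OF G]] gs)
    have Grr: "G r r = (\<Sum>i\<in>F. \<Sum>j\<in>F. q i * q j * G i j)"
      unfolding l[of r] unfolding l2 by (simp only: sum_distrib_left mult.assoc)
    have l3: "Q r y = (\<Sum>i\<in>F. q i * Q i y)" for y
      by (subst rq) (simp add: linear_sum[OF linear_bilinear_left[OF Q]] qs)
    have Qrr: "Q r r = (\<Sum>i\<in>F. (q i)\<^sup>2)"
      unfolding l3[of r] by (intro sum.cong refl) (simp add: q_def sym[of _ r] power2_eq_square)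
    have le: "(q i)\<^sup>2 \<le> Q r r" if "i \<in> F" for i
      unfolding Qrr by (rule member_le_sum) (use that finF in auto)
    have "q i * q j * G i j \<le> \<bar>G i j\<bar> * Q r r" if "i \<in> F" "j \<in> F" for i j
    proof -
      have "2 * \<bar>q i * q j\<bar> \<le> (q i)\<^sup>2 + (q j)\<^sup>2"
        using sum_squares_bound[of "\<bar>q i\<bar>" "\<bar>q j\<bar>"] by (simp add: abs_mult mult.assoc)
      then have "\<bar>q i * q j\<bar> \<le> Q r r" using le[OF that(1)] le[OF that(2)] by linarith
      then have "\<bar>q i * q j\<bar> * \<bar>G i j\<bar> \<le> Q r r * \<bar>G i j\<bar>" by (rule mult_right_mono) simp
      then show ?thesis
        using abs_ge_self[of "q i * q j * G i j"] by (simp add: abs_mult mult.commute mult.left_commute)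
    qed
    then show ?thesis
      unfolding Grr M_def sum_distrib_right by (intro sum_mono) auto
  qed
  show ?thesis
  proof (rule that[of "M + 1"])
    fix t x assume t: "M + 1 \<le> t" and x: "x \<noteq> (0::'a)"
    define p where "p = (\<Sum>b\<in>E. g x b *\<^sub>R b)"
    define r where "r = x - p"
    have pN: "p \<in> N" unfolding p_def E(2)[symmetric] by (intro span_sum span_scale span_base)
    have g_lin: "linear (\<lambda>b. g y b)" for y
      by (intro linearI) (simp_all add: g_def gs field_simps)
    have gpb: "g r b = 0" if b: "b \<in> E" for b
    proof -
      have "g p b = g x b"
        unfolding p_def by (rule ip_sum_orthonormal[OF subN ipN E(1) b])
      then show ?thesis by (simp add: r_def g_def gs)
    qed
    have rC: "r \<in> C"
      unfolding C_def using linear_eq_0_on_span[OF g_lin, of E r] gpb E(2) by auto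
    have cross: "G p r + G r p = 0"
    proof -
      have "g r p = 0" using rC pN by (simp add: C_def)
      moreover have "G p r + G r p = - 2 * g r p" by (simp add: g_def field_simps)
      ultimately show ?thesis by simp
    qed
    have xpr: "x = p + r" by (simp add: r_def)
    have Qx: "Q x x = Q r r"
    proof -
      have "Q p y = 0" "Q y p = 0" for y using pN sym[of y p] by (simp_all add: N_def)
      then show ?thesis unfolding xpr by (simp add: qs)
    qed
    have Gx: "G x x = G p p + G r r" unfolding xpr using cross by (simp add: gs)
    have Gp: "G p p \<le> 0" "p \<noteq> 0 \<Longrightarrow> G p p < 0"
      using neg[of p] pN by (cases "p = 0"; simp add: N_def gs)+
    have Gr: "G r r \<le> t * Q r r - Q r r"
    proof -
      have "(M + 1) * Q r r \<le> t * Q r r" by (rule mult_right_mono[OF t psd])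
      then show ?thesis using bound[OF rC] by (simp add: algebra_simps)
    qed
    show "G x x - t * Q x x < 0"
    proof (cases "r = 0")
      case True
      then have "p \<noteq> 0" using x xpr by simp
      then show ?thesis using Gp True by (simp add: Gx Qx gs qs)
    next
      case False
      then have "Q r r > 0" using ip_pos[OF subC ipC rC] by simp
      then show ?thesis using Gp(1) Gr by (simp add: Gx Qx)
    qed
  qed
qed

lemma direct_sum2_subset:
  assumes "direct_sum2 V1 V2 W" shows "V1 \<subseteq> W" "V2 \<subseteq> W"
proof -
  have 0: "0 \<in> V1" "0 \<in> V2" and W: "W = {v1 + v2 | v1 v2. v1 \<in> V1 \<and> v2 \<in> V2}"
    using assms by (auto simp: direct_sum2_def subspace_0)
  have "v + 0 \<in> W" if "v \<in> V1" for v unfolding W using that 0 by blast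
  moreover have "0 + v \<in> W" if "v \<in> V2" for v unfolding W using that 0 by blast
  ultimately show "V1 \<subseteq> W" "V2 \<subseteq> W" by auto
qed

lemma direct_sum_unique:
  assumes W: "direct_sum_decomposition I W UNIV"
    and w: "\<And>j. j \<in> I \<Longrightarrow> w j \<in> W j" "\<And>j. j \<in> I \<Longrightarrow> w' j \<in> W j"
    and eq: "(\<Sum>j\<in>I. w j) = (\<Sum>j\<in>I. w' j)" and j: "j \<in> I"
  shows "w j = w' j"
proof -
  let ?w = "restrict w I" and ?w' = "restrict w' I"
  have "\<exists>!u. u \<in> Pi\<^sub>E I W \<and> (\<Sum>j\<in>I. w j) = (\<Sum>j\<in>I. u j)"
    using W by (simp add: direct_sum_decomposition_def)
  then obtain u where u: "\<And>z. z \<in> Pi\<^sub>E I W \<and> (\<Sum>j\<in>I. w j) = (\<Sum>j\<in>I. z j) \<Longrightarrow> z = u"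
    by (elim ex1E) blast
  have "?w = u" by (rule u) (use w in \<open>auto intro!: sum.cong\<close>)
  moreover have "?w' = u" by (rule u) (use w eq in \<open>auto intro!: sum.cong\<close>)
  ultimately have "?w j = ?w' j" by simp
  then show ?thesis using j by simp
qed

lemma direct_sum_basis:
  fixes W :: "'i \<Rightarrow> 'v::real_vector set"
  assumes I: "finite I" and W: "direct_sum_decomposition I W UNIV"
    and E: "\<And>j. j \<in> I \<Longrightarrow> finite (E j)" "\<And>j. j \<in> I \<Longrightarrow> \<not> dependent (E j)"
      "\<And>j. j \<in> I \<Longrightarrow> span (E j) = W j"
  shows "\<not> dependent (\<Union>j\<in>I. E j)" "span (\<Union>j\<in>I. E j) = UNIV"
proof -
  have subW: "subspace (W j)" if "j \<in> I" for j
    using W that by (simp add: direct_sum_decomposition_def)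
  have W0: "0 \<in> W j" if "j \<in> I" for j using subW[OF that] by (rule subspace_0)
  have EW: "b \<in> W j" if "b \<in> E j" "j \<in> I" for b j using E(3)[OF that(2)] that(1) span_base by blast
  have disj: "E i \<inter> E j = {}" if ij: "i \<in> I" "j \<in> I" "i \<noteq> j" for i j
  proof (rule ccontr)
    assume "E i \<inter> E j \<noteq> {}"
    then obtain b where b: "b \<in> E i" "b \<in> E j" by blast
    have "(if i = i then b else 0) = (if i = j then b else 0)"
      by (rule direct_sum_unique[OF W, where w = "\<lambda>l. if l = i then b else 0" and w' = "\<lambda>l. if l = j then b else 0"])
        (use ij b EW W0 I in auto)
    then have "b = 0" using ij by simp
    then show False using E(2)[OF ij(1)] b dependent_zero by blast
  qed
  show "\<not> dependent (\<Union>j\<in>I. E j)"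
  proof -
    have "a b = 0" if sum0: "(\<Sum>b\<in>(\<Union>j\<in>I. E j). a b *\<^sub>R b) = 0" and b: "b \<in> E j" "j \<in> I" for a b j
    proof -
      have "(\<Sum>j\<in>I. \<Sum>b\<in>E j. a b *\<^sub>R b) = (\<Sum>j\<in>I. 0)"
        using sum.UNION_disjoint[of I E "\<lambda>b. a b *\<^sub>R b"] I E(1) disj sum0 by auto
      moreover have "(\<Sum>b\<in>E j. a b *\<^sub>R b) \<in> W j" if "j \<in> I" for j
        by (rule subspace_sum[OF subW[OF that]]) (rule subspace_scale[OF subW[OF that] EW[OF _ that]])
      ultimately have "(\<Sum>b\<in>E j. a b *\<^sub>R b) = 0"
        using direct_sum_unique[OF W, of "\<lambda>j. \<Sum>b\<in>E j. a b *\<^sub>R b" "\<lambda>_. 0"] W0 b(2) by blast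
      then show ?thesis
        using E(1)[OF b(2)] E(2)[OF b(2)] b(1) by (auto simp: dependent_finite)
    qed
    moreover have "finite (\<Union>j\<in>I. E j)" using I E(1) by auto
    ultimately show ?thesis by (auto simp: dependent_finite)
  qed
  show "span (\<Union>j\<in>I. E j) = UNIV"
  proof -
    have "v \<in> span (\<Union>j\<in>I. E j)" for v
    proof -
      obtain w where w: "w \<in> Pi\<^sub>E I W" "v = (\<Sum>j\<in>I. w j)"
        using W unfolding direct_sum_decomposition_def by blast
      have "w j \<in> span (\<Union>j\<in>I. E j)" if "j \<in> I" for j
        using w(1) E(3)[OF that] that span_mono[of "E j" "\<Union>j\<in>I. E j"] by blast
      then show ?thesis unfolding w(2) by (rule span_sum)
    qed
    then show ?thesis by blast
  qed
qed

lemma sum_sum_squares_zero: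
  fixes c :: "'b \<Rightarrow> 'a \<Rightarrow> real"
  assumes "finite A" "finite B" "(\<Sum>p\<in>A. \<Sum>q\<in>B. c q p * c q p) = 0" "p \<in> A" "q \<in> B"
  shows "c q p = 0"
proof -
  have "(\<Sum>q\<in>B. c q p * c q p) = 0"
    using sum_nonneg_eq_0_iff[of A "\<lambda>p. \<Sum>q\<in>B. c q p * c q p"] assms(1,3,4)
    by (simp add: sum_nonneg)
  then show ?thesis
    using sum_nonneg_eq_0_iff[of B "\<lambda>q. c q p * c q p"] assms(2,5) by simp
qed

text \<open>The part of the squared norm of a symmetrised matrix that is contributed by two opposite
off-diagonal blocks.\<close>

lemma sum_off_diagonal_blocks:
  fixes F :: "'b \<Rightarrow> 'b \<Rightarrow> real"
  assumes B: "finite B" and E: "E1 \<subseteq> B" "E2 \<subseteq> B" "E1 \<inter> E2 = {}"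
    and F: "\<And>i j. F i j \<ge> 0" "\<And>i j. F i j = F j i"
  shows "2 * (\<Sum>i\<in>E1. \<Sum>j\<in>E2. F i j) \<le> (\<Sum>i\<in>B. \<Sum>j\<in>B. F i j)"
proof -
  have fin: "finite E1" "finite E2" using E B by (auto intro: finite_subset)
  have "(\<Sum>i\<in>E2. \<Sum>j\<in>E1. F i j) = (\<Sum>i\<in>E1. \<Sum>j\<in>E2. F i j)"
    by (subst sum.swap) (subst F(2), rule refl)
  then have "2 * (\<Sum>i\<in>E1. \<Sum>j\<in>E2. F i j) = (\<Sum>i\<in>E1. \<Sum>j\<in>E2. F i j) + (\<Sum>i\<in>E2. \<Sum>j\<in>E1. F i j)"
    by simp
  also have "\<dots> = (\<Sum>p\<in>E1 \<times> E2 \<union> E2 \<times> E1. F (fst p) (snd p))"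
    using fin E(3)
    by (subst sum.union_disjoint) (auto simp: sum.cartesian_product split_beta)
  also have "\<dots> \<le> (\<Sum>p\<in>B \<times> B. F (fst p) (snd p))"
    using B E F(1) by (intro sum_mono2) auto
  also have "\<dots> = (\<Sum>i\<in>B. \<Sum>j\<in>B. F i j)" by (simp add: sum.cartesian_product split_beta)
  finally show ?thesis .
qed

section \<open>Orthonormal frames and traces\<close>

text \<open>A finite basis \<open>e\<close> together with its coordinate functionals \<open>\<xi>\<close>. Index sets make it easy to
rescale a basis and to join bases of factors, and each frame is orthonormal for exactly one inner
product, so choosing a metric amounts to choosing a frame.\<close>

locale dual_frame =
  fixes I :: "'i set" and e :: "'i \<Rightarrow> 'a::real_vector" and \<xi> :: "'i \<Rightarrow> 'a \<Rightarrow> real"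
  assumes fin [simp]: "finite I"
    and lin: "i \<in> I \<Longrightarrow> linear (\<xi> i)"
    and dual: "i \<in> I \<Longrightarrow> j \<in> I \<Longrightarrow> \<xi> i (e j) = (if i = j then 1 else 0)"
    and expand: "(\<Sum>i\<in>I. \<xi> i v *\<^sub>R e i) = v"
begin

definition frame_ip :: "'a \<Rightarrow> 'a \<Rightarrow> real" where
  "frame_ip x y = (\<Sum>i\<in>I. \<xi> i x * \<xi> i y)"

definition frame_trace :: "('a \<Rightarrow> 'a) \<Rightarrow> real" where
  "frame_trace f = (\<Sum>i\<in>I. \<xi> i (f (e i)))"

lemma coord_add: "i \<in> I \<Longrightarrow> \<xi> i (x + y) = \<xi> i x + \<xi> i y"
  and coord_diff: "i \<in> I \<Longrightarrow> \<xi> i (x - y) = \<xi> i x - \<xi> i y"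
  and coord_scale: "i \<in> I \<Longrightarrow> \<xi> i (a *\<^sub>R x) = a * \<xi> i x"
  and coord_zero: "i \<in> I \<Longrightarrow> \<xi> i 0 = 0"
  and coord_uminus: "i \<in> I \<Longrightarrow> \<xi> i (- x) = - \<xi> i x"
  and coord_sum: "i \<in> I \<Longrightarrow> \<xi> i (sum g A) = (\<Sum>a\<in>A. \<xi> i (g a))"
  using lin[of i] by (simp_all add: linear_add linear_diff linear_scale linear_0 linear_neg linear_sum)

lemma coord_ext: "(\<And>i. i \<in> I \<Longrightarrow> \<xi> i x = \<xi> i y) \<Longrightarrow> x = y"
proof -
  assume "\<And>i. i \<in> I \<Longrightarrow> \<xi> i x = \<xi> i y"
  then have "(\<Sum>i\<in>I. \<xi> i x *\<^sub>R e i) = (\<Sum>i\<in>I. \<xi> i y *\<^sub>R e i)" by simp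
  then show "x = y" by (simp only: expand)
qed

lemma linear_expand:
  assumes "linear f" shows "f v = (\<Sum>i\<in>I. \<xi> i v *\<^sub>R f (e i))"
proof -
  have "f v = f (\<Sum>i\<in>I. \<xi> i v *\<^sub>R e i)" by (simp add: expand)
  then show ?thesis by (simp add: linear_sum[OF assms] linear_scale[OF assms])
qed

lemma bilinear_frame_ip: "bilinear frame_ip"
  unfolding bilinear_def
  by (auto intro!: linearI
      simp: frame_ip_def coord_add coord_scale algebra_simps sum.distrib sum_distrib_left)

lemma frame_ip_commute: "frame_ip x y = frame_ip y x"
  by (simp add: frame_ip_def mult.commute)

lemma frame_ip_e: "i \<in> I \<Longrightarrow> frame_ip x (e i) = \<xi> i x"
  by (simp add: frame_ip_def dual if_distrib[of "\<lambda>z. _ * z"] sum.delta' cong: if_cong)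

lemma frame_ip_pos: "x \<noteq> 0 \<Longrightarrow> frame_ip x x > 0"
proof -
  assume "x \<noteq> 0"
  then obtain i where i: "i \<in> I" "\<xi> i x \<noteq> 0" using coord_ext[of x 0] coord_zero by auto
  show ?thesis unfolding frame_ip_def
    by (rule sum_pos2[OF fin i(1)]) (use i(2) in \<open>auto simp: zero_less_mult_iff neq_iff\<close>)
qed

lemma inner_product_frame_ip: "inner_product_on UNIV frame_ip"
  unfolding inner_product_on_def
  using frame_ip_pos
  by (auto simp: frame_ip_commute bilinear_ladd[OF bilinear_frame_ip] bilinear_lmul[OF bilinear_frame_ip]
      bilinear_radd[OF bilinear_frame_ip] bilinear_rmul[OF bilinear_frame_ip])

lemma frame_ip_ext: "(\<And>z. frame_ip x z = frame_ip y z) \<Longrightarrow> x = y"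
  by (rule coord_ext) (metis frame_ip_e)

lemma riesz:
  assumes "linear \<phi>" shows "frame_ip (\<Sum>i\<in>I. \<phi> (e i) *\<^sub>R e i) y = \<phi> y"
proof -
  have "frame_ip (\<Sum>i\<in>I. \<phi> (e i) *\<^sub>R e i) y = (\<Sum>i\<in>I. \<phi> (e i) * frame_ip (e i) y)"
    by (simp add: linear_sum[OF bilinear_def[THEN iffD1, OF bilinear_frame_ip, THEN conjunct2, rule_format]]
        bilinear_lmul[OF bilinear_frame_ip])
  also have "\<dots> = (\<Sum>i\<in>I. \<xi> i y *\<^sub>R \<phi> (e i))"
    by (intro sum.cong refl) (subst frame_ip_commute, simp add: frame_ip_e)
  also have "\<dots> = \<phi> y" by (rule linear_expand[OF assms, symmetric])
  finally show ?thesis .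
qed

lemma frame_trace_commute:
  assumes "linear f" "linear g"
  shows "frame_trace (\<lambda>x. f (g x)) = frame_trace (\<lambda>x. g (f x))"
proof -
  have *: "frame_trace (\<lambda>x. f (g x)) = (\<Sum>i\<in>I. \<Sum>j\<in>I. \<xi> j (g (e i)) * \<xi> i (f (e j)))"
    if "linear f" for f g :: "'a \<Rightarrow> 'a"
    unfolding frame_trace_def
    by (intro sum.cong refl, subst linear_expand[OF that]) (simp add: coord_sum coord_scale)
  show ?thesis
    unfolding *[OF assms(1)] *[OF assms(2)] by (subst sum.swap) (simp add: mult.commute)
qed

lemma frame_trace_add: "frame_trace (\<lambda>x. f x + g x) = frame_trace f + frame_trace g"
  and frame_trace_diff: "frame_trace (\<lambda>x. f x - g x) = frame_trace f - frame_trace g"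
  and frame_trace_scale: "frame_trace (\<lambda>x. a *\<^sub>R f x) = a * frame_trace f"
  by (simp_all add: frame_trace_def coord_add coord_diff coord_scale sum.distrib sum_subtractf sum_distrib_left)

lemma linear_frame_trace: "bilinear b \<Longrightarrow> linear (\<lambda>x. frame_trace (b x))"
  by (intro linearI)
    (simp_all add: frame_trace_def bilinear_ladd bilinear_lmul coord_add coord_scale sum.distrib sum_distrib_left)

lemma span_frame: "span (e ` I) = UNIV"
proof -
  have "v \<in> span (e ` I)" for v
    by (subst expand[of v, symmetric]) (intro span_sum span_scale span_base imageI)
  then show ?thesis by auto
qed

lemma independent_finite:
  fixes B :: "'a set"
  shows "\<not> dependent B \<Longrightarrow> finite B"
  using independent_span_bound[of "e ` I" B] span_frame by auto

text \<open>The trace on a subspace spanned by part of a frame. The map need only be linear on the subspace,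
which matters for transposes, since these are meaningful only there.\<close>

lemma trace_on_part:
  assumes J: "J \<subseteq> I" and eS: "\<And>j. j \<in> J \<Longrightarrow> e j \<in> S" and S: "subspace S"
    and SJ: "\<And>x i. x \<in> S \<Longrightarrow> i \<in> I - J \<Longrightarrow> \<xi> i x = 0"
    and fS: "\<And>x. x \<in> S \<Longrightarrow> f x \<in> S"
    and fadd: "\<And>x y. x \<in> S \<Longrightarrow> y \<in> S \<Longrightarrow> f (x + y) = f x + f y"
    and fscale: "\<And>a x. x \<in> S \<Longrightarrow> f (a *\<^sub>R x) = a *\<^sub>R f x"
  shows "trace_on scaleR S f = (\<Sum>j\<in>J. \<xi> j (f (e j)))"
proof -
  define B where "B = (SOME B. \<not> dependent B \<and> span B = S)"
  obtain B0 where "B0 \<subseteq> S" "independent B0" "S \<subseteq> span B0"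
    using maximal_independent_subset[of S] by blast
  then have "\<not> dependent B0 \<and> span B0 = S" using S by (metis span_subspace)
  then have B: "\<not> dependent B" "span B = S" unfolding B_def by (metis (mono_tags, lifting) someI)+
  have finB: "finite B" by (rule independent_finite) (rule B)
  have finJ: "finite J" using J fin finite_subset by blast
  have expJ: "(\<Sum>j\<in>J. \<xi> j x *\<^sub>R e j) = x" if "x \<in> S" for x
    using sum.mono_neutral_right[OF fin J, of "\<lambda>i. \<xi> i x *\<^sub>R e i"] SJ[OF that] expand[of x] by auto
  have BS: "b \<in> S" if "b \<in> B" for b using that B(2) span_base by blast
  have f0: "f 0 = 0" using fscale[of 0 0] S by (simp add: subspace_0)
  have fsum: "f (\<Sum>a\<in>A. g a) = (\<Sum>a\<in>A. f (g a))" if "finite A" "\<And>a. a \<in> A \<Longrightarrow> g a \<in> S" for g :: "'a \<Rightarrow> 'a" and A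
    using that by (induction) (auto simp: f0 fadd subspace_sum[OF S])
  have "\<xi> j (f (e j)) = (\<Sum>b\<in>B. representation B (e j) b * \<xi> j (f b))" if j: "j \<in> J" for j
  proof -
    have "e j = (\<Sum>b\<in>B. representation B (e j) b *\<^sub>R b)"
      using real_vector.sum_representation_eq[OF B(1) _ finB subset_refl, of "e j"] eS[OF j] B(2) by auto
    then have "f (e j) = f (\<Sum>b\<in>B. representation B (e j) b *\<^sub>R b)" by simp
    also have "\<dots> = (\<Sum>b\<in>B. representation B (e j) b *\<^sub>R f b)"
      by (subst fsum[OF finB]) (auto simp: BS fscale subspace_scale[OF S])
    finally show ?thesis using j J by (simp add: coord_sum coord_scale subset_iff)
  qed
  then have "(\<Sum>j\<in>J. \<xi> j (f (e j))) = (\<Sum>j\<in>J. \<Sum>b\<in>B. representation B (e j) b * \<xi> j (f b))" by simp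
  also have "\<dots> = (\<Sum>b\<in>B. \<Sum>j\<in>J. \<xi> j (f b) * representation B (e j) b)"
    by (subst sum.swap) (simp add: mult.commute)
  also have "\<dots> = (\<Sum>b\<in>B. representation B (f b) b)"
  proof (intro sum.cong refl)
    fix b assume b: "b \<in> B"
    have "representation B (\<Sum>j\<in>J. \<xi> j (f b) *\<^sub>R e j) b = (\<Sum>j\<in>J. representation B (\<xi> j (f b) *\<^sub>R e j) b)"
      by (subst real_vector.representation_sum[OF B(1)]) (auto simp: B(2) eS subspace_scale[OF S])
    also have "\<dots> = (\<Sum>j\<in>J. \<xi> j (f b) * representation B (e j) b)"
      by (intro sum.cong refl) (subst real_vector.representation_scale[OF B(1)], auto simp: B(2) eS)
    finally show "(\<Sum>j\<in>J. \<xi> j (f b) * representation B (e j) b) = representation B (f b) b"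
      using expJ[OF fS[OF BS[OF b]]] by simp
  qed
  finally show ?thesis
    unfolding trace_on_def B_def span_raw_def dependent_raw_def representation_raw_def Let_def by simp
qed

lemma trace_on_UNIV: "linear f \<Longrightarrow> trace_on scaleR UNIV f = frame_trace f"
  unfolding frame_trace_def by (rule trace_on_part) (auto simp: linear_add linear_scale)

end

lemma dual_frame_basis:
  fixes B :: "'a::real_vector set"
  assumes "finite B" "\<not> dependent B" "span B = UNIV"
  shows "dual_frame B (\<lambda>b. b) (\<lambda>b v. representation B v b)"
proof (rule dual_frame.intro)
  show "linear (\<lambda>v. representation B v b)" if "b \<in> B" for b
    using assms by (intro linearI) (simp_all add: real_vector.representation_add real_vector.representation_scale)
  show "representation B j i = (if i = j then 1 else 0)" if "i \<in> B" "j \<in> B" for i j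
    using real_vector.representation_basis[OF assms(2), of j] that by auto
  show "(\<Sum>b\<in>B. representation B v b *\<^sub>R b) = v" for v
    by (rule real_vector.sum_representation_eq) (use assms in auto)
qed fact

lemma dual_frame_scale:
  assumes "dual_frame I e \<xi>" "\<And>i. i \<in> I \<Longrightarrow> s i \<noteq> 0"
  shows "dual_frame I (\<lambda>i. (1 / s i) *\<^sub>R e i) (\<lambda>i v. s i * \<xi> i v)"
proof -
  interpret dual_frame I e \<xi> by fact
  show ?thesis
  proof (rule dual_frame.intro)
    show "linear (\<lambda>v. s i * \<xi> i v)" if "i \<in> I" for i
      using that by (intro linearI) (simp_all add: coord_add coord_scale algebra_simps)
    show "(\<Sum>i\<in>I. (s i * \<xi> i v) *\<^sub>R (1 / s i) *\<^sub>R e i) = v" for v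
      using assms(2) by (subst (2) expand[of v, symmetric]) (auto intro!: sum.cong)
  qed (use assms(2) in \<open>auto simp: coord_scale dual\<close>)
qed

lemma dual_frame_prod:
  assumes "dual_frame I e \<xi>" "dual_frame J f \<eta>"
  shows "dual_frame (I <+> J) (case_sum (\<lambda>i. (e i, 0)) (\<lambda>j. (0, f j)))
           (case_sum (\<lambda>i p. \<xi> i (fst p)) (\<lambda>j p. \<eta> j (snd p)))"
proof -
  interpret A: dual_frame I e \<xi> by fact
  interpret B: dual_frame J f \<eta> by fact
  show ?thesis
  proof (rule dual_frame.intro)
    show "linear (case_sum (\<lambda>i p. \<xi> i (fst p)) (\<lambda>j p. \<eta> j (snd p)) k)" if "k \<in> I <+> J" for k
      using that by (auto intro!: linearI simp: A.coord_add B.coord_add A.coord_scale B.coord_scale)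
  qed (auto simp: sum.Plus A.dual B.dual A.coord_zero B.coord_zero prod_eq_iff A.expand B.expand
      fst_sum snd_sum split: if_splits)
qed

lemma dual_frame_real: "dual_frame {()} (\<lambda>_. 1::real) (\<lambda>_ x. x)"
  by (rule dual_frame.intro) (auto intro!: linearI)

lemma dual_frame_orthonormal:
  assumes ip: "inner_product_on UNIV ip" and E: "orthonormal UNIV ip E" "span E = UNIV"
  shows "dual_frame E (\<lambda>b. b) (\<lambda>b x. ip x b)"
proof (rule dual_frame.intro)
  show "finite E" using E by (simp add: orthonormal_def)
  show "linear (\<lambda>x. ip x b)" if "b \<in> E" for b
    by (intro linearI) (simp_all add: ip_add[OF subspace_UNIV ip] ip_scale[OF subspace_UNIV ip])
  show "ip j i = (if i = j then 1 else 0)" if "i \<in> E" "j \<in> E" for i j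
    using E that by (auto simp: orthonormal_def)
  show "(\<Sum>b\<in>E. ip v b *\<^sub>R b) = v" for v
    by (rule span_orthonormal_coords[OF subspace_UNIV ip E(1)]) (simp add: E(2))
qed

section \<open>The Ricci tensor of a metric Lie algebra\<close>

locale metric_algebra = dual_frame I e \<xi>
  for I :: "'i set" and e :: "'i \<Rightarrow> 'g::real_vector" and \<xi> :: "'i \<Rightarrow> 'g \<Rightarrow> real" +
  fixes br :: "'g \<Rightarrow> 'g \<Rightarrow> 'g"
  assumes bil: "bilinear br" and anti: "br y x = - br x y"
begin

lemmas br_simps = bilinear_ladd[OF bil] bilinear_radd[OF bil] bilinear_lmul[OF bil]
  bilinear_rmul[OF bil] bilinear_lsub[OF bil] bilinear_rsub[OF bil] bilinear_lneg[OF bil]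
  bilinear_rneg[OF bil]

lemmas frame_ip_simps = bilinear_ladd[OF bilinear_frame_ip] bilinear_radd[OF bilinear_frame_ip]
  bilinear_lmul[OF bilinear_frame_ip] bilinear_rmul[OF bilinear_frame_ip] bilinear_lsub[OF bilinear_frame_ip]
  bilinear_rsub[OF bilinear_frame_ip] bilinear_lneg[OF bilinear_frame_ip] bilinear_rneg[OF bilinear_frame_ip]

lemma br_self: "br x x = 0"
proof -
  have "br x x + br x x = 0" by (subst (1) anti) (rule left_minus)
  then have "2 *\<^sub>R br x x = 0" by (simp only: scaleR_2)
  then show ?thesis by simp
qed

definition koszul :: "'g \<Rightarrow> 'g \<Rightarrow> 'g \<Rightarrow> real" where
  "koszul x y z = (frame_ip (br x y) z - frame_ip (br y z) x + frame_ip (br z x) y) / 2"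

definition nabla :: "'g \<Rightarrow> 'g \<Rightarrow> 'g" where
  "nabla x y = (\<Sum>i\<in>I. koszul x y (e i) *\<^sub>R e i)"

lemma frame_ip_nabla: "frame_ip (nabla x y) z = koszul x y z"
proof -
  have "linear (koszul x y)"
    by (intro linearI) (simp_all add: koszul_def br_simps frame_ip_simps field_simps)
  then show ?thesis unfolding nabla_def by (rule riesz)
qed

lemma bilinear_nabla: "bilinear nabla"
  unfolding bilinear_def
  by (intro conjI allI linearI; rule frame_ip_ext)
    (simp_all add: frame_ip_simps frame_ip_nabla koszul_def br_simps field_simps)

lemma nabla_torsion: "nabla x y - nabla y x = br x y"
proof (rule frame_ip_ext)
  fix z
  show "frame_ip (nabla x y - nabla y x) z = frame_ip (br x y) z"
    using anti[of x y] anti[of x z] anti[of z y]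
    by (simp add: frame_ip_simps frame_ip_nabla koszul_def field_simps)
qed

lemma nabla_metric: "frame_ip (nabla x y) z + frame_ip y (nabla x z) = 0"
  using anti[of x y] anti[of x z] anti[of z y]
  by (simp add: frame_ip_commute[of y] frame_ip_simps frame_ip_nabla koszul_def field_simps)

text \<open>Existence is the Koszul formula. For uniqueness, add the metric identity for the three cyclic
permutations of \<open>x, y, z\<close> and replace differences by brackets: this leaves \<open>frame_ip (D x y) z\<close> in terms of
the bracket.\<close>

lemma levi_civita_eq: "levi_civita br frame_ip = nabla"
  unfolding levi_civita_def
proof (rule the_equality)
  show "bilinear nabla \<and> (\<forall>x y. nabla x y - nabla y x = br x y) \<and>
        (\<forall>x y z. frame_ip (nabla x y) z + frame_ip y (nabla x z) = 0)"
    using bilinear_nabla nabla_torsion nabla_metric by blast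
next
  fix D assume D: "bilinear D \<and> (\<forall>x y. D x y - D y x = br x y) \<and>
        (\<forall>x y z. frame_ip (D x y) z + frame_ip y (D x z) = 0)"
  show "D = nabla"
  proof (intro ext frame_ip_ext)
    fix x y z
    have t: "br a b = D a b - D b a" for a b using D by simp
    have m: "frame_ip (D a b) c + frame_ip (D a c) b = 0" for a b c using D by (metis frame_ip_commute)
    show "frame_ip (D x y) z = frame_ip (nabla x y) z"
      unfolding frame_ip_nabla koszul_def t
      using m[of x y z] m[of y z x] m[of z x y] by (simp add: frame_ip_simps)
  qed
qed

lemmas nabla_simps = bilinear_ladd[OF bilinear_nabla] bilinear_radd[OF bilinear_nabla]
  bilinear_lmul[OF bilinear_nabla] bilinear_rmul[OF bilinear_nabla]
  bilinear_lneg[OF bilinear_nabla]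

lemma curvature_eq:
  "curvature br frame_ip z x y = nabla z (nabla x y) - nabla x (nabla z y) - nabla (br z x) y"
  by (simp add: curvature_def levi_civita_eq Let_def)

lemma ricci_tensor_eq: "ricci_tensor br frame_ip x y = (\<Sum>i\<in>I. \<xi> i (curvature br frame_ip (e i) x y))"
proof -
  have "linear (\<lambda>z. curvature br frame_ip z x y)"
    by (intro linearI) (simp_all add: curvature_eq nabla_simps br_simps algebra_simps)
  then show ?thesis unfolding ricci_tensor_def by (simp add: trace_on_UNIV frame_trace_def)
qed

lemma linear_ricci_tensor: "linear (ricci_tensor br frame_ip x)"
proof -
  have c: "curvature br frame_ip z x (y + y') = curvature br frame_ip z x y + curvature br frame_ip z x y'"
          "curvature br frame_ip z x (a *\<^sub>R y) = a *\<^sub>R curvature br frame_ip z x y" for z y y' a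
    by (simp_all add: curvature_eq nabla_simps algebra_simps)
  show ?thesis
    by (intro linearI)
      (simp_all add: ricci_tensor_eq c coord_add coord_scale sum.distrib sum_distrib_left)
qed

lemma frame_ip_ricci_operator: "frame_ip (ricci_operator br frame_ip x) y = ricci_tensor br frame_ip x y"
proof -
  have "ricci_operator br frame_ip x = (\<Sum>i\<in>I. ricci_tensor br frame_ip x (e i) *\<^sub>R e i)"
    unfolding ricci_operator_def
    by (rule the_equality) (auto simp: riesz[OF linear_ricci_tensor] intro!: frame_ip_ext)
  then show ?thesis by (simp add: riesz[OF linear_ricci_tensor])
qed

lemma negative_ricci_iff:
  "negative_ricci br frame_ip \<longleftrightarrow> (\<forall>x. x \<noteq> 0 \<longrightarrow> ricci_tensor br frame_ip x x < 0)"
  by (simp add: negative_ricci_def frame_ip_ricci_operator)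

lemma frame_trace_br: "frame_trace (br w) = (\<Sum>k\<in>I. \<xi> k w * frame_trace (br (e k)))"
proof -
  have "linear (\<lambda>w. br w y)" for y using bil by (simp add: bilinear_def)
  from linear_expand[OF this, of w]
  have "frame_trace (br w) = (\<Sum>i\<in>I. \<Sum>k\<in>I. \<xi> k w * \<xi> i (br (e k) (e i)))"
    unfolding frame_trace_def by (simp add: coord_sum coord_scale)
  also have "\<dots> = (\<Sum>k\<in>I. \<xi> k w * frame_trace (br (e k)))"
    unfolding frame_trace_def sum_distrib_left by (rule sum.swap)
  finally show ?thesis .
qed

text \<open>Write \<open>A\<close> for the map \<open>y \<mapsto> nabla y x\<close> and \<open>a\<close> for \<open>ad x\<close>. Metricity and torsion-freeness turn the
trace of the curvature into \<open>tr(A\<^sup>T A) + tr(A\<^sup>T a) + tr(A a)\<close> minus the trace of \<open>ad (nabla x x)\<close>. The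
Koszul formula gives \<open>A = - S - J / 2\<close> with \<open>S\<close> the symmetric part of \<open>a\<close> and \<open>J\<close> the skew map
\<open>\<langle>J y, z\<rangle> = \<langle>[y, z], x\<rangle>\<close>, and the formula becomes \<open>- tr S\<^sup>2 + \<bar>J\<bar>\<^sup>2 / 4\<close> minus the same trace.\<close>

theorem ricci_formula:
  "ricci_tensor br frame_ip x x =
     (\<Sum>i\<in>I. \<Sum>j\<in>I. (frame_ip (br (e i) (e j)) x)\<^sup>2) / 4
   - (\<Sum>i\<in>I. \<Sum>j\<in>I. (\<xi> j (br x (e i)) + \<xi> i (br x (e j)))\<^sup>2) / 4
   - (\<Sum>k\<in>I. frame_ip (br (e k) x) x * frame_trace (br (e k)))"
proof -
  define a where "a i j = \<xi> j (br x (e i))" for i j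
  define J where "J i j = frame_ip (br (e i) (e j)) x" for i j
  define A where "A i j = \<xi> j (nabla (e i) x)" for i j
  have Jskew: "J j i = - J i j" for i j
    unfolding J_def by (subst anti) (simp add: frame_ip_simps)
  have A: "A i j = - (a i j + a j i + J i j) / 2" if "i \<in> I" "j \<in> I" for i j
    using that Jskew[of i j] anti[of "e i" x]
    by (simp add: A_def a_def J_def frame_ip_e[symmetric] frame_ip_nabla koszul_def frame_ip_simps field_simps)
  have t1: "\<xi> i (nabla (e i) w) = - \<xi> i (br w (e i))" if "i \<in> I" for i w
    using that anti[of "e i" w]
    by (simp add: frame_ip_e[symmetric] frame_ip_nabla koszul_def frame_ip_simps br_self bilinear_lzero[OF bilinear_frame_ip])
  have t2: "\<xi> i (nabla x (nabla (e i) x)) = - (\<Sum>j\<in>I. A i j * (A i j + a i j))" if "i \<in> I" for i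
  proof -
    have n: "nabla x (e i) = nabla (e i) x + br x (e i)"
      using nabla_torsion[of x "e i"] by (simp add: algebra_simps)
    have "\<xi> i (nabla x (nabla (e i) x)) = frame_ip (nabla x (nabla (e i) x)) (e i)"
      using that by (simp add: frame_ip_e)
    also have "\<dots> = - frame_ip (nabla (e i) x) (nabla x (e i))"
      using nabla_metric[of x "nabla (e i) x" "e i"] by linarith
    also have "\<dots> = - (\<Sum>j\<in>I. A i j * (A i j + a i j))"
      unfolding n by (subst frame_ip_def) (simp add: coord_add A_def a_def)
    finally show ?thesis .
  qed
  have t3: "\<xi> i (nabla (br (e i) x) x) = - (\<Sum>j\<in>I. a i j * A j i)" if "i \<in> I" for i
  proof -
    have l: "linear (\<lambda>y. nabla y x)" using bilinear_nabla by (simp add: bilinear_def)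
    have "nabla (br (e i) x) x = - nabla (br x (e i)) x"
      using anti[of "e i" x] by (simp add: nabla_simps)
    also have "nabla (br x (e i)) x = (\<Sum>j\<in>I. a i j *\<^sub>R nabla (e j) x)"
      by (subst linear_expand[OF l]) (simp add: a_def)
    finally show ?thesis using that by (simp add: coord_uminus coord_sum coord_scale A_def)
  qed
  have tr: "(\<Sum>i\<in>I. \<xi> i (br (nabla x x) (e i))) = (\<Sum>k\<in>I. frame_ip (br (e k) x) x * frame_trace (br (e k)))"
  proof -
    have "\<xi> k (nabla x x) = frame_ip (br (e k) x) x" if "k \<in> I" for k
      using that anti[of "e k" x]
      by (simp add: frame_ip_e[symmetric] frame_ip_nabla koszul_def frame_ip_simps br_self bilinear_lzero[OF bilinear_frame_ip])
    then show ?thesis using frame_trace_br[of "nabla x x"] by (simp add: frame_trace_def)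
  qed
  have "ricci_tensor br frame_ip x x =
      (\<Sum>i\<in>I. - \<xi> i (br (nabla x x) (e i)) + (\<Sum>j\<in>I. A i j * (A i j + a i j)) + (\<Sum>j\<in>I. a i j * A j i))"
    unfolding ricci_tensor_eq curvature_eq
    by (intro sum.cong refl) (simp add: coord_diff t1 t2 t3)
  also have "\<dots> = - (\<Sum>k\<in>I. frame_ip (br (e k) x) x * frame_trace (br (e k)))
      + (\<Sum>i\<in>I. \<Sum>j\<in>I. A i j * (A i j + a i j) + a i j * A j i)" (is "_ = _ + ?T")
    by (simp add: sum.distrib sum_subtractf sum_negf tr)
  also have "?T = (\<Sum>i\<in>I. \<Sum>j\<in>I. (A i j * (A i j + a i j) + a i j * A j i
      + (A j i * (A j i + a j i) + a j i * A i j)) / 2)"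
  proof -
    \<comment> \<open>Averaging over the exchange of \<open>i\<close> and \<open>j\<close> removes the product of the symmetric matrix
      \<open>a i j + a j i\<close> with the skew matrix \<open>J\<close>.\<close>
    have half: "t = (t + s) / 2" if "t = s" for t s :: real using that by simp
    have "?T = (?T + (\<Sum>i\<in>I. \<Sum>j\<in>I. A j i * (A j i + a j i) + a j i * A i j)) / 2"
      by (rule half) (rule sum.swap)
    also have "\<dots> = (\<Sum>i\<in>I. \<Sum>j\<in>I. (A i j * (A i j + a i j) + a i j * A j i
      + (A j i * (A j i + a j i) + a j i * A i j)) / 2)"
      by (simp only: sum.distrib[symmetric] sum_divide_distrib)
    finally show ?thesis .
  qed
  also have "\<dots> = (\<Sum>i\<in>I. \<Sum>j\<in>I. (J i j)\<^sup>2 / 4 - (a i j + a j i)\<^sup>2 / 4)"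
  proof (intro sum.cong refl)
    fix i j assume "i \<in> I" "j \<in> I"
    then show "(A i j * (A i j + a i j) + a i j * A j i
      + (A j i * (A j i + a j i) + a j i * A i j)) / 2 = (J i j)\<^sup>2 / 4 - (a i j + a j i)\<^sup>2 / 4"
      using Jskew[of i j] by (simp add: A) (simp add: power2_eq_square field_simps)
  qed
  also have "\<dots> = (\<Sum>i\<in>I. \<Sum>j\<in>I. (J i j)\<^sup>2) / 4 - (\<Sum>i\<in>I. \<Sum>j\<in>I. (a i j + a j i)\<^sup>2) / 4"
    by (simp add: sum_subtractf sum_divide_distrib)
  finally show ?thesis by (simp add: a_def J_def algebra_simps)
qed

end

section \<open>The Ricci tensor of a semidirect product\<close>

text \<open>Orthonormal frames of \<open>\<uu>\<close> and \<open>V\<close>, with \<open>D\<close> diagonal in the latter. The joint frame adds the unit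
vector \<open>Z\<close> in front.\<close>

locale semidirect_frames = U: dual_frame I e \<xi> + V: dual_frame J f \<eta>
  for I :: "'i set" and e :: "'i \<Rightarrow> 'u::real_vector" and \<xi>
    and J :: "'j set" and f :: "'j \<Rightarrow> 'v::real_vector" and \<eta> +
  fixes br :: "'u \<Rightarrow> 'u \<Rightarrow> 'u" and \<pi> :: "'u \<Rightarrow> 'v \<Rightarrow> 'v" and D :: "'v \<Rightarrow> 'v" and \<gamma> :: "'j \<Rightarrow> real"
  assumes bil: "bilinear br" and anti: "br y x = - br x y"
    and bil_\<pi>: "bilinear \<pi>" and lin_D: "linear D"
    and eigen: "j \<in> J \<Longrightarrow> D (f j) = \<gamma> j *\<^sub>R f j"
begin

abbreviation "K \<equiv> ({()} <+> I) <+> J"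
abbreviation "E \<equiv> case_sum (\<lambda>i. (case_sum (\<lambda>_. (1::real, 0)) (\<lambda>j. (0, e j)) i, 0)) (\<lambda>j. (0, f j))"
abbreviation "\<Xi> \<equiv> case_sum (\<lambda>i p. case_sum (\<lambda>_ p. fst p) (\<lambda>j p. \<xi> j (snd p)) i (fst p)) (\<lambda>j p. \<eta> j (snd p))"

abbreviation "sbr \<equiv> semidirect_bracket br \<pi> D"

lemma frame_sum: "dual_frame K E \<Xi>"
  using dual_frame_prod[OF dual_frame_prod[OF dual_frame_real U.dual_frame_axioms] V.dual_frame_axioms] .

lemma sbr_eq: "sbr p q = ((0, br (snd (fst p)) (snd (fst q))),
    (fst (fst p) *\<^sub>R D (snd q) + \<pi> (snd (fst p)) (snd q)) - (fst (fst q) *\<^sub>R D (snd p) + \<pi> (snd (fst q)) (snd p)))"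
  by (simp add: semidirect_bracket_def split_beta)

lemmas zero_simps = bilinear_lzero[OF bil] bilinear_rzero[OF bil] bilinear_lzero[OF bil_\<pi>]
  bilinear_rzero[OF bil_\<pi>] linear_0[OF lin_D]

sublocale G: metric_algebra K E \<Xi> sbr
proof (intro metric_algebra.intro frame_sum metric_algebra_axioms.intro)
  show "bilinear sbr"
    unfolding bilinear_def
    by (auto intro!: linearI simp: semidirect_bracket_def split_beta bilinear_ladd[OF bil]
        bilinear_radd[OF bil] bilinear_ladd[OF bil_\<pi>] bilinear_radd[OF bil_\<pi>] bilinear_lmul[OF bil]
        bilinear_rmul[OF bil] bilinear_lmul[OF bil_\<pi>] bilinear_rmul[OF bil_\<pi>]
        linear_add[OF lin_D] linear_scale[OF lin_D] algebra_simps)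
  show "sbr y x = - sbr x y" for x y
    using anti[of "snd (fst x)" "snd (fst y)"]
    by (simp add: semidirect_bracket_def split_beta)
qed

lemma sum_K: "sum F K = F (Inl (Inl ())) + (\<Sum>i\<in>I. F (Inl (Inr i))) + (\<Sum>j\<in>J. F (Inr j))"
  by (simp add: sum.Plus)

lemma frame_ip_G: "G.frame_ip p q = fst (fst p) * fst (fst q) + U.frame_ip (snd (fst p)) (snd (fst q)) + V.frame_ip (snd p) (snd q)"
  by (simp add: G.frame_ip_def U.frame_ip_def V.frame_ip_def sum_K)

lemma coord_D: "j \<in> J \<Longrightarrow> \<eta> j (D v) = \<gamma> j * \<eta> j v"
proof -
  assume j: "j \<in> J"
  have "\<eta> j (D v) = (\<Sum>i\<in>J. \<eta> i v * \<eta> j (D (f i)))"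
    using j by (subst V.linear_expand[OF lin_D]) (simp add: V.coord_sum V.coord_scale)
  also have "\<dots> = (\<Sum>i\<in>J. if j = i then \<gamma> j * \<eta> j v else 0)"
    using j by (intro sum.cong refl) (simp add: eigen V.coord_scale V.dual)
  finally show ?thesis using j by simp
qed

lemma frame_trace_G: "G.frame_trace (sbr ((a, x), v)) = a * sum \<gamma> J + U.frame_trace (br x) + V.frame_trace (\<pi> x)"
  by (simp add: G.frame_trace_def U.frame_trace_def V.frame_trace_def sum_K sbr_eq zero_simps eigen
      V.coord_add V.coord_scale V.dual sum.distrib sum_distrib_left)

text \<open>The tracelessness assumptions remove the mixed terms: \<open>tr (D \<circ> \<pi>(x))\<close> is the only product of the
\<open>Z\<close>- and the \<open>\<uu>\<close>-component, and the other two leave \<open>Z\<close> as the only frame vector \<open>w\<close> with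
\<open>tr (ad w) \<noteq> 0\<close>. The terms \<open>\<bar>D v\<bar>\<^sup>2\<close> from \<open>S\<close> and from \<open>J\<close> cancel because \<open>D\<close> is symmetric.\<close>

theorem ricci_semidirect:
  assumes tr_br: "\<And>x. U.frame_trace (br x) = 0" and tr_\<pi>: "\<And>x. V.frame_trace (\<pi> x) = 0"
    and tr_D\<pi>: "\<And>x. V.frame_trace (\<lambda>w. D (\<pi> x w)) = 0"
  shows "ricci_tensor sbr G.frame_ip ((a, x), v) ((a, x), v) =
      (\<Sum>i\<in>I. \<Sum>j\<in>I. (U.frame_ip (br (e i) (e j)) x)\<^sup>2) / 4
    - (\<Sum>i\<in>I. \<Sum>j\<in>I. (\<xi> j (br x (e i)) + \<xi> i (br x (e j)))\<^sup>2) / 4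
    - (\<Sum>i\<in>J. \<Sum>j\<in>J. (\<eta> j (\<pi> x (f i)) + \<eta> i (\<pi> x (f j)))\<^sup>2) / 4
    - a\<^sup>2 * (\<Sum>j\<in>J. (\<gamma> j)\<^sup>2)
    - sum \<gamma> J * (\<Sum>j\<in>J. \<gamma> j * (\<eta> j v)\<^sup>2)
    + (\<Sum>i\<in>I. \<Sum>j\<in>J. (V.frame_ip (\<pi> (e i) (f j)) v)\<^sup>2) / 2
    - (\<Sum>i\<in>I. \<Sum>j\<in>J. (\<eta> j (\<pi> (e i) v))\<^sup>2) / 2"
proof -
  define y where "y = ((a, x), v)"
  note simps = sbr_eq zero_simps frame_ip_G V.coord_zero U.coord_zero
    bilinear_lzero[OF U.bilinear_frame_ip] bilinear_lzero[OF V.bilinear_frame_ip] V.coord_uminus V.coord_diff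
    bilinear_lneg[OF V.bilinear_frame_ip] bilinear_lmul[OF V.bilinear_frame_ip]
  define P where "P = (\<Sum>j\<in>J. (\<gamma> j * \<eta> j v)\<^sup>2)"
  have s1: "(\<Sum>p\<in>K. \<Sum>q\<in>K. (G.frame_ip (sbr (E p) (E q)) y)\<^sup>2) =
      (\<Sum>i\<in>I. \<Sum>j\<in>I. (U.frame_ip (br (e i) (e j)) x)\<^sup>2) + 2 * P
      + 2 * (\<Sum>i\<in>I. \<Sum>j\<in>J. (V.frame_ip (\<pi> (e i) (f j)) v)\<^sup>2)"
  proof -
    have "(\<Sum>j\<in>J. \<Sum>i\<in>I. (V.frame_ip (\<pi> (e i) (f j)) v)\<^sup>2) = (\<Sum>i\<in>I. \<Sum>j\<in>J. (V.frame_ip (\<pi> (e i) (f j)) v)\<^sup>2)"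
      by (rule sum.swap)
    moreover have "(\<Sum>j\<in>J. (V.frame_ip (D (f j)) v)\<^sup>2) = P"
      unfolding P_def
      by (intro sum.cong refl) (simp add: eigen bilinear_lmul[OF V.bilinear_frame_ip]
          V.frame_ip_commute[of "f _"] V.frame_ip_e)
    ultimately show ?thesis
      unfolding y_def sum_K by (simp add: simps sum.distrib)
  qed
  have s2: "(\<Sum>p\<in>K. \<Sum>q\<in>K. (\<Xi> q (sbr y (E p)) + \<Xi> p (sbr y (E q)))\<^sup>2) =
      (\<Sum>i\<in>I. \<Sum>j\<in>I. (\<xi> j (br x (e i)) + \<xi> i (br x (e j)))\<^sup>2) + 2 * P
      + 2 * (\<Sum>i\<in>I. \<Sum>j\<in>J. (\<eta> j (\<pi> (e i) v))\<^sup>2)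
      + 4 * a\<^sup>2 * (\<Sum>j\<in>J. (\<gamma> j)\<^sup>2)
      + (\<Sum>i\<in>J. \<Sum>j\<in>J. (\<eta> j (\<pi> x (f i)) + \<eta> i (\<pi> x (f j)))\<^sup>2)"
  proof -
    have sw: "(\<Sum>j\<in>J. \<Sum>i\<in>I. (\<eta> j (\<pi> (e i) v))\<^sup>2) = (\<Sum>i\<in>I. \<Sum>j\<in>J. (\<eta> j (\<pi> (e i) v))\<^sup>2)"
      by (rule sum.swap)
    have DP: "(\<Sum>j\<in>J. (\<eta> j (D v))\<^sup>2) = P"
      unfolding P_def by (intro sum.cong refl) (simp add: coord_D)
    define Q where "Q i j = \<eta> j (\<pi> x (f i)) + \<eta> i (\<pi> x (f j))" for i j
    have "(\<Sum>i\<in>J. \<Sum>j\<in>J. (\<eta> j (a *\<^sub>R D (f i) + \<pi> x (f i)) + \<eta> i (a *\<^sub>R D (f j) + \<pi> x (f j)))\<^sup>2)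
       = (\<Sum>i\<in>J. \<Sum>j\<in>J. (Q i j)\<^sup>2 + (if i = j then 4 * a\<^sup>2 * (\<gamma> i)\<^sup>2 + 8 * a * (\<gamma> i * \<eta> i (\<pi> x (f i))) else 0))"
      by (intro sum.cong refl)
        (auto simp: V.coord_add V.coord_scale eigen V.dual Q_def power2_eq_square algebra_simps)
    also have "\<dots> = (\<Sum>i\<in>J. \<Sum>j\<in>J. (Q i j)\<^sup>2) + 4 * a\<^sup>2 * (\<Sum>j\<in>J. (\<gamma> j)\<^sup>2)
        + 8 * a * (\<Sum>j\<in>J. \<gamma> j * \<eta> j (\<pi> x (f j)))"
      by (simp add: sum.distrib sum_distrib_left)
    also have "(\<Sum>j\<in>J. \<gamma> j * \<eta> j (\<pi> x (f j))) = 0"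
      using tr_D\<pi>[of x] by (simp add: V.frame_trace_def coord_D)
    finally show ?thesis
      unfolding y_def sum_K by (simp add: simps sum.distrib sw DP Q_def)
  qed
  have s3: "(\<Sum>p\<in>K. G.frame_ip (sbr (E p) y) y * G.frame_trace (sbr (E p))) = sum \<gamma> J * (\<Sum>j\<in>J. \<gamma> j * (\<eta> j v)\<^sup>2)"
  proof -
    have "V.frame_ip (D v) v = (\<Sum>j\<in>J. \<gamma> j * (\<eta> j v)\<^sup>2)"
      by (simp add: V.frame_ip_def coord_D power2_eq_square mult.assoc)
    moreover have "G.frame_trace (sbr ((0, x'), w)) = 0" "G.frame_trace (sbr ((1, 0), 0)) = sum \<gamma> J" for x' w
      using tr_br tr_\<pi> by (simp_all add: frame_trace_G)
    then have "G.frame_trace (sbr (0, w)) = 0" "G.frame_trace (sbr ((0, x'), w)) = 0" "G.frame_trace (sbr ((1, 0), 0)) = sum \<gamma> J" for x' w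
      by (simp_all add: zero_prod_def)
    ultimately show ?thesis
      unfolding y_def sum_K by (simp add: sbr_eq zero_simps frame_ip_G bilinear_lzero[OF U.bilinear_frame_ip])
  qed
  show ?thesis
    unfolding y_def[symmetric] G.ricci_formula s1 s2 s3 by (simp add: field_simps)
qed

lemma frame_ip_cauchy: "(V.frame_ip p q)\<^sup>2 \<le> V.frame_ip p p * V.frame_ip q q"
  using Cauchy_Schwarz_ineq_sum[of "\<lambda>j. \<eta> j p" "\<lambda>j. \<eta> j q" J]
  by (simp add: V.frame_ip_def power2_eq_square)

text \<open>Dividing the frame of \<open>\<uu>\<close> by \<open>\<rho>\<close> changes nothing in the block on \<open>\<uu>\<close> and on \<open>Z\<close>, whereas on \<open>V\<close> the one
positive term is divided by \<open>\<rho>\<^sup>2\<close>. It is then dominated by \<open>(tr D) \<langle>D v, v\<rangle>\<close>.\<close>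

theorem negative_ricci_after_scaling:
  assumes tr_br: "\<And>x. U.frame_trace (br x) = 0" and tr_\<pi>: "\<And>x. V.frame_trace (\<pi> x) = 0"
    and tr_D\<pi>: "\<And>x. V.frame_trace (\<lambda>w. D (\<pi> x w)) = 0"
    and J: "J \<noteq> {}" and \<gamma>: "\<And>j. j \<in> J \<Longrightarrow> \<gamma> j > 0"
    and neg: "\<And>x. x \<noteq> 0 \<Longrightarrow>
      (\<Sum>i\<in>I. \<Sum>j\<in>I. (U.frame_ip (br (e i) (e j)) x)\<^sup>2) / 4
    - (\<Sum>i\<in>I. \<Sum>j\<in>I. (\<xi> j (br x (e i)) + \<xi> i (br x (e j)))\<^sup>2) / 4
    - (\<Sum>i\<in>J. \<Sum>j\<in>J. (\<eta> j (\<pi> x (f i)) + \<eta> i (\<pi> x (f j)))\<^sup>2) / 4 < 0"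
  shows "\<exists>ip. inner_product_on UNIV ip \<and> negative_ricci sbr ip"
proof -
  define m where "m = Min (\<gamma> ` J)"
  have m: "m > 0" "\<And>j. j \<in> J \<Longrightarrow> m \<le> \<gamma> j"
    using \<gamma> J V.fin by (auto simp: m_def)
  define T where "T = sum \<gamma> J"
  have T: "T > 0" unfolding T_def using V.fin J \<gamma> by (intro sum_pos)
  define M where "M = (\<Sum>i\<in>I. \<Sum>j\<in>J. V.frame_ip (\<pi> (e i) (f j)) (\<pi> (e i) (f j)))"
  have frame_ip_nonneg: "V.frame_ip p p \<ge> 0" for p by (auto simp: V.frame_ip_def intro: sum_nonneg)
  have M: "M \<ge> 0" unfolding M_def by (intro sum_nonneg frame_ip_nonneg)
  \<comment> \<open>\<open>M\<close> bounds the positive term, by Cauchy--Schwarz, and \<open>T * m\<close> bounds the negative one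
    from below, so \<open>M \<le> T m \<rho>\<^sup>2\<close> is what is needed; \<open>M + 1\<close> keeps \<open>\<rho>\<close> positive.\<close>
  define \<rho> where "\<rho> = sqrt ((M + 1) / (T * m))"
  have \<rho>: "\<rho> > 0" "\<rho>\<^sup>2 = (M + 1) / (T * m)" using M T m by (simp_all add: \<rho>_def)
  have fr: "dual_frame I (\<lambda>i. (1 / \<rho>) *\<^sub>R e i) (\<lambda>i v. \<rho> * \<xi> i v)"
    using \<rho>(1) by (intro dual_frame_scale[OF U.dual_frame_axioms]) simp
  interpret S: semidirect_frames I "\<lambda>i. (1 / \<rho>) *\<^sub>R e i" "\<lambda>i v. \<rho> * \<xi> i v" J f \<eta> br \<pi> D \<gamma>
    by (intro semidirect_frames.intro fr V.dual_frame_axioms semidirect_frames_axioms.intro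
        bil anti bil_\<pi> lin_D eigen)
  have frame_ip: "S.U.frame_ip x y = \<rho>\<^sup>2 * U.frame_ip x y" for x y
    by (simp add: S.U.frame_ip_def U.frame_ip_def sum_distrib_left power2_eq_square mult_ac)
  have tr: "S.U.frame_trace (br x) = 0" for x
    using tr_br[of x] \<rho>(1) by (simp add: S.U.frame_trace_def U.frame_trace_def bilinear_rmul[OF bil] U.coord_scale)
  have "ricci_tensor sbr S.G.frame_ip y y < 0" if y: "y \<noteq> 0" for y
  proof -
    obtain a x v where y_eq: "y = ((a, x), v)" by (metis prod.collapse)
    let ?A = "(\<Sum>i\<in>I. \<Sum>j\<in>I. (U.frame_ip (br (e i) (e j)) x)\<^sup>2) / 4
      - (\<Sum>i\<in>I. \<Sum>j\<in>I. (\<xi> j (br x (e i)) + \<xi> i (br x (e j)))\<^sup>2) / 4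
      - (\<Sum>i\<in>J. \<Sum>j\<in>J. (\<eta> j (\<pi> x (f i)) + \<eta> i (\<pi> x (f j)))\<^sup>2) / 4"
    have A: "x \<noteq> 0 \<Longrightarrow> ?A < 0" "?A \<le> 0"
      using neg[of x] by (cases "x = 0"; simp add: bilinear_rzero[OF U.bilinear_frame_ip] zero_simps
          U.coord_zero V.coord_zero)+
    have s1: "(S.U.frame_ip (br ((1 / \<rho>) *\<^sub>R e i) ((1 / \<rho>) *\<^sub>R e j)) x)\<^sup>2 = (U.frame_ip (br (e i) (e j)) x)\<^sup>2" for i j
      using \<rho>(1) by (simp add: frame_ip bilinear_lmul[OF bil] bilinear_rmul[OF bil]
          bilinear_lmul[OF U.bilinear_frame_ip] power2_eq_square)
    have s2: "(\<Sum>i\<in>I. \<Sum>j\<in>I. (\<rho> * \<xi> j (br x ((1 / \<rho>) *\<^sub>R e i)) + \<rho> * \<xi> i (br x ((1 / \<rho>) *\<^sub>R e j)))\<^sup>2)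
        = (\<Sum>i\<in>I. \<Sum>j\<in>I. (\<xi> j (br x (e i)) + \<xi> i (br x (e j)))\<^sup>2)"
      using \<rho>(1) by (intro sum.cong refl) (simp add: bilinear_rmul[OF bil] U.coord_scale)
    have s3: "(\<Sum>i\<in>I. \<Sum>j\<in>J. (V.frame_ip (\<pi> ((1 / \<rho>) *\<^sub>R e i) (f j)) v)\<^sup>2) \<le> M / \<rho>\<^sup>2 * V.frame_ip v v"
    proof -
      have "(V.frame_ip (\<pi> ((1 / \<rho>) *\<^sub>R e i) (f j)) v)\<^sup>2
          \<le> V.frame_ip (\<pi> (e i) (f j)) (\<pi> (e i) (f j)) * (V.frame_ip v v / \<rho>\<^sup>2)" for i j
        using frame_ip_cauchy[of "\<pi> (e i) (f j)" v] \<rho>(1)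
        by (simp add: bilinear_lmul[OF bil_\<pi>] bilinear_lmul[OF V.bilinear_frame_ip] power_divide
            divide_right_mono)
      then have "(\<Sum>i\<in>I. \<Sum>j\<in>J. (V.frame_ip (\<pi> ((1 / \<rho>) *\<^sub>R e i) (f j)) v)\<^sup>2)
          \<le> (\<Sum>i\<in>I. \<Sum>j\<in>J. V.frame_ip (\<pi> (e i) (f j)) (\<pi> (e i) (f j)) * (V.frame_ip v v / \<rho>\<^sup>2))"
        by (intro sum_mono)
      also have "\<dots> = M / \<rho>\<^sup>2 * V.frame_ip v v" unfolding M_def by (simp only: sum_distrib_right[symmetric]) simp
      finally show ?thesis .
    qed
    have s4: "(\<Sum>j\<in>J. \<gamma> j * (\<eta> j v)\<^sup>2) \<ge> m * V.frame_ip v v"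
    proof -
      have "m * V.frame_ip v v = (\<Sum>j\<in>J. m * (\<eta> j v)\<^sup>2)"
        by (simp add: V.frame_ip_def sum_distrib_left power2_eq_square)
      also have "\<dots> \<le> (\<Sum>j\<in>J. \<gamma> j * (\<eta> j v)\<^sup>2)" by (intro sum_mono mult_right_mono m(2)) auto
      finally show ?thesis .
    qed
    have "T * (\<Sum>j\<in>J. \<gamma> j * (\<eta> j v)\<^sup>2) \<ge> T * (m * V.frame_ip v v)"
      using s4 T by (intro mult_left_mono) auto
    moreover have "M / \<rho>\<^sup>2 \<le> T * m"
    proof -
      have "T * m * \<rho>\<^sup>2 = M + 1" using \<rho>(2) T m by simp
      then have "M \<le> T * m * \<rho>\<^sup>2" by simp
      then show ?thesis using \<rho>(1) by (simp add: divide_le_eq)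
    qed
    then have "M / \<rho>\<^sup>2 * V.frame_ip v v \<le> T * m * V.frame_ip v v" by (rule mult_right_mono[OF _ frame_ip_nonneg])
    ultimately have v_part: "- (T * (\<Sum>j\<in>J. \<gamma> j * (\<eta> j v)\<^sup>2))
        + (\<Sum>i\<in>I. \<Sum>j\<in>J. (V.frame_ip (\<pi> ((1 / \<rho>) *\<^sub>R e i) (f j)) v)\<^sup>2) / 2 \<le> - (T * m * V.frame_ip v v) / 2"
      using s3 by (simp add: algebra_simps)
    have last: "(\<Sum>i\<in>I. \<Sum>j\<in>J. (\<eta> j (\<pi> ((1 / \<rho>) *\<^sub>R e i) v))\<^sup>2) \<ge> 0"
      by (intro sum_nonneg) auto
    have Gpos: "(\<Sum>j\<in>J. (\<gamma> j)\<^sup>2) > 0" by (intro sum_pos V.fin J zero_less_power \<gamma>)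
    have R: "ricci_tensor sbr S.G.frame_ip y y \<le> ?A - a\<^sup>2 * (\<Sum>j\<in>J. (\<gamma> j)\<^sup>2) - (T * m * V.frame_ip v v) / 2"
      unfolding y_eq S.ricci_semidirect[OF tr tr_\<pi> tr_D\<pi>] s1 s2 T_def[symmetric]
      using v_part last by linarith
    have a: "a\<^sup>2 * (\<Sum>j\<in>J. (\<gamma> j)\<^sup>2) \<ge> 0" "a \<noteq> 0 \<Longrightarrow> a\<^sup>2 * (\<Sum>j\<in>J. (\<gamma> j)\<^sup>2) > 0"
      using Gpos by simp_all
    have v: "T * m * V.frame_ip v v \<ge> 0" "v \<noteq> 0 \<Longrightarrow> T * m * V.frame_ip v v > 0"
      using T m frame_ip_nonneg V.frame_ip_pos by simp_all
    have "x \<noteq> 0 \<or> a \<noteq> 0 \<or> v \<noteq> 0" using y by (auto simp: y_eq zero_prod_def)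
    then show ?thesis using R A a v by argo
  qed
  then have "negative_ricci sbr S.G.frame_ip" by (simp add: S.G.negative_ricci_iff)
  then show ?thesis using S.G.inner_product_frame_ip by blast
qed

end

section \<open>Compact semisimple Lie algebras\<close>

text \<open>With the Killing form negative definite, its negative is an inner product for which all \<open>ad x\<close> are
skew. Trivial centre, perfectness and semisimplicity of every \<open>ad x\<close> follow from this.\<close>

locale compact_lie_algebra =
  fixes br :: "'u::real_vector \<Rightarrow> 'u \<Rightarrow> 'u"
  assumes compact: "compact_semisimple br"
begin

lemma lie: "lie_algebra scaleR br"
  using compact by (simp add: compact_semisimple_def)

lemma bil: "bilinear br"
  using lie_algebra.linear_right[OF lie] lie_algebra.linear_left[OF lie]
  by (simp add: bilinear_def Real_Vector_Spaces.linear_def)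

lemmas br_simps = bilinear_ladd[OF bil] bilinear_radd[OF bil] bilinear_lmul[OF bil]
  bilinear_rmul[OF bil] bilinear_lsub[OF bil] bilinear_rsub[OF bil] bilinear_lneg[OF bil]
  bilinear_rneg[OF bil] bilinear_lzero[OF bil] bilinear_rzero[OF bil]

lemma linear_br: "linear (br x)"
  using bil by (simp add: bilinear_def)

lemma br_self: "br x x = 0"
  by (rule lie_algebra.bracket_self[OF lie])

lemma br_anti: "br y x = - br x y"
proof -
  have "br (x + y) (x + y) = br x y + br y x"
    by (simp only: br_simps) (simp add: br_self)
  then have "br x y + br y x = 0" by (simp only: br_self)
  then show ?thesis by (simp add: eq_neg_iff_add_eq_0 add.commute)
qed

lemma br_br: "br (br x y) z = br x (br y z) - br y (br x z)"
proof -
  have "br z (br x y) = - br (br x y) z" "br y (br z x) = - br y (br x z)"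
    using br_anti[of z "br x y"] br_anti[of z x] by (simp_all add: br_simps)
  then show ?thesis
    using lie_algebra.jacobi[OF lie, of x y z] by (simp add: algebra_simps)
qed

definition neg_killing :: "'u \<Rightarrow> 'u \<Rightarrow> real" where
  "neg_killing x y = - killing_form scaleR br x y"

lemma fin_dim: "fin_dim (scaleR :: real \<Rightarrow> 'u \<Rightarrow> 'u)"
  using compact by (simp add: compact_semisimple_def)

lemma basis_exists: obtains B :: "'u set" where "finite B" "\<not> dependent B" "span B = UNIV"
  by (rule subspace_basis[OF fin_dim subspace_UNIV])

lemma frame_exists:
  obtains B :: "'u set" and e :: "'u \<Rightarrow> 'u" and \<xi> where "dual_frame B e \<xi>"
  by (rule basis_exists) (rule that[OF dual_frame_basis])

lemma neg_killing_frame: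
  assumes "dual_frame I e \<xi>"
  shows "neg_killing x y = - dual_frame.frame_trace I e \<xi> (\<lambda>z. br x (br y z))"
proof -
  interpret dual_frame I e \<xi> by fact
  have "linear (\<lambda>z. br x (br y z))" by (intro linearI) (simp_all add: br_simps)
  then show ?thesis by (simp add: neg_killing_def killing_form_def trace_on_UNIV)
qed

lemma neg_killing_commute: "neg_killing x y = neg_killing y x"
  and neg_killing_add: "neg_killing (x + x') y = neg_killing x y + neg_killing x' y"
  and neg_killing_scale: "neg_killing (a *\<^sub>R x) y = a * neg_killing x y"
  and neg_killing_skew: "neg_killing (br x y) z = - neg_killing y (br x z)"
proof -
  obtain B :: "'u set" and e :: "'u \<Rightarrow> 'u" and \<xi> where B: "dual_frame B e \<xi>" by (rule frame_exists)
  interpret dual_frame B e \<xi> by fact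
  note k = neg_killing_frame[OF B]
  show "neg_killing x y = neg_killing y x"
    unfolding k by (simp add: frame_trace_commute[OF linear_br linear_br])
  show "neg_killing (x + x') y = neg_killing x y + neg_killing x' y" "neg_killing (a *\<^sub>R x) y = a * neg_killing x y"
    unfolding k by (simp_all add: br_simps frame_trace_add frame_trace_scale)
  have l: "linear (\<lambda>w. br y (br z w))" by (intro linearI) (simp_all add: br_simps)
  show "neg_killing (br x y) z = - neg_killing y (br x z)"
    unfolding k br_br
    by (simp add: br_simps frame_trace_diff frame_trace_commute[OF linear_br[of x] l])
qed

lemma neg_killing_scale_right: "neg_killing y (a *\<^sub>R x) = a * neg_killing y x"
  by (simp add: neg_killing_commute[of y] neg_killing_scale)

lemma neg_killing_pos: "x \<noteq> 0 \<Longrightarrow> neg_killing x x > 0"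
  using compact by (simp add: neg_killing_def compact_semisimple_def)

lemma inner_product_neg_killing: "inner_product_on UNIV neg_killing"
  unfolding inner_product_on_def by (intro conjI ballI allI impI neg_killing_commute neg_killing_add neg_killing_scale neg_killing_pos)

lemma neg_killing_self: "neg_killing x x = 0 \<Longrightarrow> x = 0"
  using neg_killing_pos[of x] by force

lemma neg_killing_zero: "neg_killing 0 y = 0"
  using neg_killing_scale[of 0 0 y] by simp

text \<open>A skew map has the same kernel as its square.\<close>

lemma br_nilpotent:
  assumes "(br x ^^ n) y = 0" shows "br x y = 0"
  using assms
proof (induction n arbitrary: y)
  case 0
  then show ?case by (simp add: br_simps)
next
  case (Suc n)
  show ?case
  proof (cases n)
    case 0
    then show ?thesis using Suc.prems by simp
  next
    case (Suc m)
    from Suc.prems have "(br x ^^ n) (br x y) = 0" by (simp add: funpow_swap1)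
    then have "br x (br x y) = 0" by (rule Suc.IH)
    then have "neg_killing (br x y) (br x y) = 0"
      using neg_killing_skew[of x y "br x y"] neg_killing_zero neg_killing_commute by simp
    then show ?thesis by (rule neg_killing_self)
  qed
qed

lemma center_trivial: "(\<And>y. br x y = 0) \<Longrightarrow> x = 0"
proof (rule neg_killing_self)
  assume x: "\<And>y. br x y = 0"
  obtain B :: "'u set" and e :: "'u \<Rightarrow> 'u" and \<xi> where B: "dual_frame B e \<xi>" by (rule frame_exists)
  show "neg_killing x x = 0"
    by (simp add: neg_killing_frame[OF B] x dual_frame.frame_trace_def[OF B] dual_frame.coord_zero[OF B])
qed

lemma orthonormal_basis_extending:
  assumes "orthonormal UNIV neg_killing E0"
  obtains E where "E0 \<subseteq> E" "orthonormal UNIV neg_killing E" "span E = UNIV"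
proof -
  obtain B :: "'u set" where B: "finite B" "\<not> dependent B" "span B = UNIV" by (rule basis_exists)
  obtain E where E: "E0 \<subseteq> E" "orthonormal UNIV neg_killing E" "span E = span (E0 \<union> B)"
    using orthonormal_extend[OF subspace_UNIV inner_product_neg_killing assms B(1)] by blast
  have "span (E0 \<union> B) = UNIV" using span_mono[of B "E0 \<union> B"] B(3) by blast
  then show ?thesis using that E by simp
qed

lemma subspace_orthonormal_basis:
  assumes "subspace h"
  obtains E where "orthonormal UNIV neg_killing E" "span E = h"
proof -
  have "inner_product_on h neg_killing" by (rule inner_product_on_subset[OF inner_product_neg_killing]) simp
  from orthonormal_basis[OF fin_dim assms this]
  obtain E where "orthonormal h neg_killing E" "span E = h" .
  then show ?thesis using that by (auto simp: orthonormal_def)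
qed

text \<open>A vector orthogonal to all brackets is central by skewness of \<open>ad\<close>, hence zero.\<close>

lemma perfect: "span {br x y | x y. True} = UNIV"
proof -
  let ?S = "span {br x y | x y. True}"
  obtain E where E: "orthonormal UNIV neg_killing E" "span E = ?S"
    by (rule subspace_orthonormal_basis[OF subspace_span])
  have "z \<in> ?S" for z
  proof -
    define p where "p = (\<Sum>b\<in>E. neg_killing z b *\<^sub>R b)"
    have p: "p \<in> ?S" unfolding p_def E(2)[symmetric] by (intro span_sum span_scale span_base)
    have "neg_killing (z - p) b = 0" if "b \<in> E" for b
      using ip_sum_orthonormal[OF subspace_UNIV inner_product_neg_killing E(1) that, of "neg_killing z"]
        neg_killing_add[of "z - p" p b] by (simp add: p_def)
    moreover have "w = (\<Sum>b\<in>E. neg_killing w b *\<^sub>R b)" if "w \<in> ?S" for w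
      using span_orthonormal_coords[OF subspace_UNIV inner_product_neg_killing E(1)] that E(2) by simp
    ultimately have orth: "neg_killing w (z - p) = 0" if "w \<in> ?S" for w
    proof -
      assume a: "\<And>b. b \<in> E \<Longrightarrow> neg_killing (z - p) b = 0" and b: "\<And>w. w \<in> ?S \<Longrightarrow> w = (\<Sum>b\<in>E. neg_killing w b *\<^sub>R b)"
      have "neg_killing w (z - p) = neg_killing (\<Sum>b\<in>E. neg_killing w b *\<^sub>R b) (z - p)" using b[OF that] by simp
      also have "\<dots> = 0"
      proof (subst ip_sum[OF subspace_UNIV inner_product_neg_killing])
        show "finite E" using E(1) by (simp add: orthonormal_def)
        show "(\<Sum>b\<in>E. neg_killing (neg_killing w b *\<^sub>R b) (z - p)) = 0"
          by (intro sum.neutral ballI) (simp add: neg_killing_scale_right a neg_killing_commute[of _ "z - p"])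
      qed auto
      finally show ?thesis .
    qed
    have "br (z - p) y = 0" for y
    proof (rule neg_killing_self)
      have "neg_killing (br (z - p) y) (br (z - p) y) = - neg_killing (br y (z - p)) (br (z - p) y)"
        using neg_killing_scale[of "-1" "br y (z - p)"] by (subst (1) br_anti) simp
      also have "\<dots> = neg_killing (z - p) (br y (br (z - p) y))"
        by (simp add: neg_killing_skew)
      also have "\<dots> = 0"
        by (subst neg_killing_commute) (rule orth, rule span_base, blast)
      finally show "neg_killing (br (z - p) y) (br (z - p) y) = 0" .
    qed
    then have "z - p = 0" by (rule center_trivial)
    then show ?thesis using p by simp
  qed
  then show ?thesis by blast
qed

text \<open>Used for traces, which vanish on commutators.\<close>

lemma linear_vanishes:
  assumes "linear \<phi>" "\<And>x y. \<phi> (br x y) = 0"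
  shows "\<phi> x = 0"
proof (rule linear_eq_0_on_span[OF assms(1)])
  show "x \<in> span {br x y | x y. True}" using perfect by simp
qed (use assms(2) in auto)

text \<open>The inequality says that the Ricci form of the metric is negative on \<open>h - {0}\<close>. Take a
Killing-orthonormal basis of \<open>h\<close>, continue it to one of the whole algebra by vectors \<open>i\<close>, and give the new
vectors distinct integer lengths \<open>n i\<close>. For \<open>x \<in> h\<close> the Killing matrix \<open>k i j\<close> of \<open>ad x\<close> is skew and lives on
the new vectors, as \<open>h\<close> is abelian. Because \<open>\<langle>[i, j], x\<rangle>\<close> is again \<open>k i j\<close>, both sides are sums over
\<open>(k i j)\<^sup>2 / (n i n j)\<^sup>2\<close>, with weights \<open>1\<close> on the left and \<open>((n j)\<^sup>2 - (n i)\<^sup>2)\<^sup>2 > 1\<close> on the right. Some entry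
of \<open>k\<close> is nonzero since the centre is trivial.\<close>

lemma abelian_metric:
  assumes h: "subspace h" and ab: "\<And>x y. x \<in> h \<Longrightarrow> y \<in> h \<Longrightarrow> br x y = 0"
  obtains I :: "'u set" and e \<xi> where "dual_frame I e \<xi>"
    "\<And>x. x \<in> h \<Longrightarrow> x \<noteq> 0 \<Longrightarrow>
       (\<Sum>i\<in>I. \<Sum>j\<in>I. (dual_frame.frame_ip I \<xi> (br (e i) (e j)) x)\<^sup>2)
       < (\<Sum>i\<in>I. \<Sum>j\<in>I. (\<xi> j (br x (e i)) + \<xi> i (br x (e j)))\<^sup>2)"
proof -
  obtain F0 where F0: "orthonormal UNIV neg_killing F0" "span F0 = h"
    by (rule subspace_orthonormal_basis[OF h])
  obtain F where F: "F0 \<subseteq> F" "orthonormal UNIV neg_killing F" "span F = UNIV"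
    by (rule orthonormal_basis_extending[OF F0(1)])
  have fin: "finite F" using F by (simp add: orthonormal_def)
  obtain g :: "'u \<Rightarrow> nat" where g: "inj_on g F"
    using finite_imp_inj_to_nat_seg[OF fin] by blast
  define n where "n b = (if b \<in> F0 then 1 else real (Suc (g b)))" for b
  have n0: "n b > 0" for b by (simp add: n_def)
  interpret K: dual_frame F "\<lambda>b. b" "\<lambda>b x. neg_killing x b"
    by (rule dual_frame_orthonormal[OF inner_product_neg_killing F(2,3)])
  have fr: "dual_frame F (\<lambda>b. (1 / n b) *\<^sub>R b) (\<lambda>b x. n b * neg_killing x b)"
    by (rule dual_frame_scale[OF K.dual_frame_axioms]) (simp add: n_def)
  interpret M: dual_frame F "\<lambda>b. (1 / n b) *\<^sub>R b" "\<lambda>b x. n b * neg_killing x b" by (rule fr)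
  have main: "(\<Sum>i\<in>F. \<Sum>j\<in>F. (M.frame_ip (br ((1 / n i) *\<^sub>R i) ((1 / n j) *\<^sub>R j)) x)\<^sup>2)
       < (\<Sum>i\<in>F. \<Sum>j\<in>F. (n j * neg_killing (br x ((1 / n i) *\<^sub>R i)) j + n i * neg_killing (br x ((1 / n j) *\<^sub>R j)) i)\<^sup>2)"
    if x: "x \<in> h" "x \<noteq> 0" for x
  proof -
    define k where "k i j = neg_killing (br x i) j" for i j
    have kskew: "k j i = - k i j" for i j
      unfolding k_def by (subst neg_killing_skew) (simp only: neg_killing_commute[of i])
    have k0: "k i j = 0" if "i \<in> F0 \<or> j \<in> F0" for i j
    proof -
      have *: "k b c = 0" if "b \<in> F0" for b c
      proof -
        have "b \<in> h" using that F0(2) span_base by blast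
        then show ?thesis using ab[OF x(1)] by (simp add: k_def neg_killing_zero)
      qed
      from *[of i j] *[of j i] show ?thesis using that kskew[of i j] by auto
    qed
    have xF0: "neg_killing x b = 0" if "b \<in> F" "b \<notin> F0" for b
    proof -
      have "x = (\<Sum>c\<in>F0. neg_killing x c *\<^sub>R c)"
        using span_orthonormal_coords[OF subspace_UNIV inner_product_neg_killing F0(1)] F0(2) x(1) by simp
      also have "neg_killing \<dots> b = (\<Sum>c\<in>F0. neg_killing x c * neg_killing c b)"
        using F0(1) by (subst ip_sum[OF subspace_UNIV inner_product_neg_killing]) (auto simp: orthonormal_def neg_killing_scale)
      also have "\<dots> = 0"
      proof (intro sum.neutral ballI)
        fix c assume "c \<in> F0"
        then have "c \<in> F" "c \<noteq> b" using that F(1) by auto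
        then show "neg_killing x c * neg_killing c b = 0" using that F(2) by (simp add: orthonormal_def)
      qed
      finally show ?thesis .
    qed
    have fx: "M.frame_ip w x = neg_killing w x" for w
    proof -
      have "M.frame_ip w x = (\<Sum>b\<in>F. neg_killing x b * neg_killing w b)"
        unfolding M.frame_ip_def using xF0 by (intro sum.cong refl) (auto simp: n_def)
      also have "\<dots> = neg_killing (\<Sum>b\<in>F. neg_killing x b *\<^sub>R b) w"
        by (subst ip_sum[OF subspace_UNIV inner_product_neg_killing]) (simp_all add: fin neg_killing_scale neg_killing_commute[of w])
      finally show ?thesis by (simp only: K.expand neg_killing_commute[of w])
    qed
    have l: "M.frame_ip (br ((1 / n i) *\<^sub>R i) ((1 / n j) *\<^sub>R j)) x = k i j / (n i * n j)" for i j
    proof -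
      have "neg_killing (br i j) x = k i j"
        unfolding k_def using neg_killing_skew[of i j x] neg_killing_scale_right[of j "-1" "br x i"]
        by (simp add: br_anti[of i x] neg_killing_commute[of _ j])
      then show ?thesis by (simp add: fx br_simps neg_killing_scale)
    qed
    have r: "n j * neg_killing (br x ((1 / n i) *\<^sub>R i)) j + n i * neg_killing (br x ((1 / n j) *\<^sub>R j)) i
        = k i j * ((n j)\<^sup>2 - (n i)\<^sup>2) / (n i * n j)" for i j
      using n0[of i] n0[of j] kskew[of i j]
      by (simp add: br_simps neg_killing_scale k_def[symmetric] field_simps power2_eq_square)
    have gap: "((n j)\<^sup>2 - (n i)\<^sup>2)\<^sup>2 > 1" if "i \<in> F" "j \<in> F" "i \<notin> F0" "j \<notin> F0" "i \<noteq> j" for i j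
    proof -
      define a b where "a = int (Suc (g i))" and "b = int (Suc (g j))"
      have ab: "a \<ge> 1" "b \<ge> 1" "a \<noteq> b" using that g by (auto simp: a_def b_def inj_on_def)
      have "(b\<^sup>2 - a\<^sup>2) = (b - a) * (b + a)" by (simp add: power2_eq_square algebra_simps)
      moreover have "\<bar>b - a\<bar> \<ge> 1" "\<bar>b + a\<bar> \<ge> 2" using ab by auto
      then have "1 * 2 \<le> \<bar>b - a\<bar> * \<bar>b + a\<bar>" by (intro mult_mono) auto
      ultimately have "\<bar>b\<^sup>2 - a\<^sup>2\<bar> > 1" by (simp add: abs_mult)
      then have "(b\<^sup>2 - a\<^sup>2)\<^sup>2 > 1"
        using power_strict_mono[of 1 "\<bar>b\<^sup>2 - a\<^sup>2\<bar>" 2] by simp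
      then have "real_of_int ((b\<^sup>2 - a\<^sup>2)\<^sup>2) > 1" by linarith
      then show ?thesis using that by (simp add: n_def a_def b_def)
    qed
    have le: "(k i j / (n i * n j))\<^sup>2 \<le> (k i j * ((n j)\<^sup>2 - (n i)\<^sup>2) / (n i * n j))\<^sup>2
        \<and> (k i j \<noteq> 0 \<longrightarrow> (k i j / (n i * n j))\<^sup>2 < (k i j * ((n j)\<^sup>2 - (n i)\<^sup>2) / (n i * n j))\<^sup>2)"
      if "i \<in> F" "j \<in> F" for i j
    proof (cases "k i j = 0")
      case False
      then have "i \<notin> F0" "j \<notin> F0" "i \<noteq> j" using k0 kskew[of i i] by auto
      from gap[OF that this] have "(k i j / (n i * n j))\<^sup>2 * 1 < (k i j / (n i * n j))\<^sup>2 * ((n j)\<^sup>2 - (n i)\<^sup>2)\<^sup>2"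
        using False n0[of i] n0[of j] by (intro mult_strict_left_mono) auto
      then show ?thesis by (simp add: power_divide power_mult_distrib)
    qed simp
    obtain i j where ij: "i \<in> F" "j \<in> F" "k i j \<noteq> 0"
    proof -
      have "\<exists>y. br x y \<noteq> 0" using center_trivial x(2) by blast
      then obtain y where y: "br x y \<noteq> 0" ..
      have "\<exists>i\<in>F. br x i \<noteq> 0"
      proof (rule ccontr)
        assume "\<not> (\<exists>i\<in>F. br x i \<noteq> 0)"
        then have "br x y = 0" by (subst K.linear_expand[OF linear_br]) simp
        then show False using y by simp
      qed
      then obtain i where i: "i \<in> F" "br x i \<noteq> 0" by blast
      then have "\<exists>j\<in>F. k i j \<noteq> 0" using K.coord_ext[of "br x i" 0] by (auto simp: k_def neg_killing_zero)
      then show ?thesis using that i by blast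
    qed
    show ?thesis
      unfolding l r
    proof (rule sum_strict_mono_ex1[OF fin])
      show "\<forall>i\<in>F. (\<Sum>j\<in>F. (k i j / (n i * n j))\<^sup>2) \<le> (\<Sum>j\<in>F. (k i j * ((n j)\<^sup>2 - (n i)\<^sup>2) / (n i * n j))\<^sup>2)"
        using le by (intro ballI sum_mono) blast
      show "\<exists>i\<in>F. (\<Sum>j\<in>F. (k i j / (n i * n j))\<^sup>2) < (\<Sum>j\<in>F. (k i j * ((n j)\<^sup>2 - (n i)\<^sup>2) / (n i * n j))\<^sup>2)"
        using ij le by (intro bexI[OF _ ij(1)] sum_strict_mono_ex1[OF fin] ballI bexI[OF _ ij(2)]) auto
    qed
  qed
  show ?thesis by (rule that[OF fr]) (use main in blast)
qed

end

section \<open>The real form in terms of root vectors\<close>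

lemma cscale_add: "cscale c (p + q) = cscale c p + cscale c q"
  and cscale_scaleR: "cscale c (r *\<^sub>R p) = r *\<^sub>R cscale c p"
  by (simp_all add: cscale_def prod_eq_iff algebra_simps)

lemma linear_fst_i: "linear (\<lambda>p. fst (cscale \<i> p))"
  by (intro linearI) (simp_all add: cscale_add cscale_scaleR)

lemma ihR_eq: "ihR H \<Delta> = (\<lambda>p. fst (cscale \<i> p)) ` span (H ` \<Delta>)"
  by (simp add: ihR_def image_image)

lemma subspace_ihR: "subspace (ihR H \<Delta>)"
  unfolding ihR_eq by (rule linear_subspace_image[OF linear_fst_i subspace_span])

context
  fixes br :: "'u::real_vector \<Rightarrow> 'u \<Rightarrow> 'u" and h P H X N
  assumes compact: "compact_semisimple br"
    and cartan: "cartan_subalgebra cscale (cbracket br) h"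
    and pos: "positive_system (croots br h) P"
    and adapted: "adapted_root_vectors br h H X N"
begin

interpretation compact_lie_algebra br
  by unfold_locales (rule compact)

interpretation C: vector_space "cscale :: complex \<Rightarrow> 'u \<times> 'u \<Rightarrow> 'u \<times> 'u"
  by (rule vector_space_cscale)

lemma real_form: "range (\<lambda>x. (x, 0)) =
    span ((\<lambda>\<alpha>. cscale \<i> (H \<alpha>)) ` croots br h \<union> Xup X ` croots br h \<union> Yup X ` croots br h)"
  and H_in: "\<alpha> \<in> croots br h \<Longrightarrow> H \<alpha> \<in> h"
  using adapted by (simp_all add: adapted_root_vectors_def Let_def)

text \<open>The real form contains \<open>i H\<^sub>\<alpha>\<close>, so \<open>(x, 0)\<close> is \<open>i\<close> times an element of the real span of the
\<open>H\<^sub>\<alpha>\<close>, and the Cartan subalgebra is a complex subspace.\<close>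

lemma ihR_in_h:
  assumes "x \<in> ihR H (croots br h)" shows "(x, 0) \<in> h"
proof -
  have sub: "C.subspace h" using cartan by (simp add: cartan_subalgebra_def)
  obtain p where p: "p \<in> span (H ` croots br h)" "x = fst (cscale \<i> p)"
    using assms by (auto simp: ihR_eq)
  have "subspace h"
    using C.subspace_0[OF sub] C.subspace_add[OF sub] C.subspace_scale[OF sub]
    by (auto simp: subspace_def simp flip: cscale_of_real)
  then have "p \<in> h" using p(1) H_in span_minimal[of "H ` croots br h" h] by blast
  then have ip: "cscale \<i> p \<in> h" by (rule C.subspace_scale[OF sub])
  have "cscale \<i> p \<in> range (\<lambda>x. (x, 0))"
    using p(1)
  proof (induction rule: span_induct_alt)
    case base
    then show ?case by (auto simp: cscale_def zero_prod_def)
  next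
    case (step c q y)
    have "cscale \<i> q \<in> range (\<lambda>x. (x, 0))" unfolding real_form using step(1) by (intro span_base) auto
    then show ?case using step(2) unfolding cscale_add cscale_scaleR by auto
  qed
  then have "cscale \<i> p = (x, 0)" using p(2) by auto
  then show ?thesis using ip by simp
qed

text \<open>The Cartan subalgebra is nilpotent, so a power of \<open>ad x\<close> annihilates \<open>y\<close>. As \<open>ad x\<close> is skew, already
\<open>ad x\<close> itself does.\<close>

lemma ihR_abelian:
  assumes "x \<in> ihR H (croots br h)" "y \<in> ihR H (croots br h)"
  shows "br x y = 0"
proof -
  have xy: "(x, 0) \<in> h" "(y, 0) \<in> h" using assms ihR_in_h by auto
  obtain n where n: "lower_central cscale (cbracket br) h n = {0}"
    using cartan by (auto simp: cartan_subalgebra_def)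
  have "((br x ^^ m) y, 0) \<in> lower_central cscale (cbracket br) h m" for m
  proof (induction m)
    case 0
    then show ?case using xy by simp
  next
    case (Suc m)
    have "cbracket br (x, 0) ((br x ^^ m) y, 0) = ((br x ^^ Suc m) y, 0)"
      by (simp add: cbracket_def br_simps)
    then have "((br x ^^ Suc m) y, 0) \<in> {cbracket br x y | x y. x \<in> h \<and> y \<in> lower_central cscale (cbracket br) h m}"
      using Suc xy(1) by (metis (mono_tags, lifting) mem_Collect_eq)
    then show ?case by (simp only: lower_central.simps) (rule C.span_base)
  qed
  from this[of n] have "(br x ^^ n) y = 0" using n by (simp add: zero_prod_def)
  then show ?thesis by (rule br_nilpotent)
qed

text \<open>The real form is spanned by \<open>i H\<^sub>\<alpha>\<close>, \<open>X\<^sup>\<alpha>\<close>, \<open>Y\<^sup>\<alpha>\<close> over all roots; \<open>X\<^sup>\<alpha> = - X\<^sup>-\<^sup>\<alpha>\<close> and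
\<open>Y\<^sup>\<alpha> = Y\<^sup>-\<^sup>\<alpha>\<close> reduce the last two families to positive ones.\<close>

lemma real_form_decomposition:
  obtains T r where "T \<in> ihR H (croots br h)" "r \<in> span (Xu X ` P \<union> Yu X ` P)" "x = T + r"
proof -
  let ?S = "Xu X ` P \<union> Yu X ` P" and ?T = "ihR H (croots br h)"
  let ?A = "(\<lambda>\<alpha>. cscale \<i> (H \<alpha>)) ` croots br h \<union> Xup X ` croots br h \<union> Yup X ` croots br h"
  have pm: "\<alpha> \<in> P \<or> - \<alpha> \<in> P" if "\<alpha> \<in> croots br h" for \<alpha>
    using pos that unfolding positive_system_def by blast
  have "fst q \<in> span (?T \<union> ?S)" if "q \<in> ?A" for q
  proof -
    from that consider \<alpha> where "\<alpha> \<in> croots br h" "q = cscale \<i> (H \<alpha>)"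
      | \<alpha> where "\<alpha> \<in> croots br h" "q = Xup X \<alpha>" | \<alpha> where "\<alpha> \<in> croots br h" "q = Yup X \<alpha>" by blast
    then show ?thesis
    proof cases
      case 1
      then have "fst q \<in> ?T" unfolding ihR_eq using span_base[of "H \<alpha>" "H ` croots br h"] by blast
      then show ?thesis by (simp add: span_base)
    next
      case 2
      have "Xu X \<alpha> = - Xu X (- \<alpha>)" by (simp add: Xu_def Xup_def)
      then have "Xu X \<alpha> \<in> span ?S"
        using pm[OF 2(1)] by (metis UnCI image_eqI span_base span_neg)
      then have "fst q \<in> span ?S" using 2 by (simp add: Xu_def)
      then show ?thesis using span_mono[of ?S "?T \<union> ?S"] by blast
    next
      case 3
      have "Yu X \<alpha> = Yu X (- \<alpha>)" by (simp add: Yu_def Yup_def add.commute)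
      then have "Yu X \<alpha> \<in> span ?S"
        using pm[OF 3(1)] by (metis UnCI image_eqI span_base)
      then have "fst q \<in> span ?S" using 3 by (simp add: Yu_def)
      then show ?thesis using span_mono[of ?S "?T \<union> ?S"] by blast
    qed
  qed
  then have "fst ` ?A \<subseteq> span (?T \<union> ?S)" by blast
  then have "span (fst ` ?A) \<subseteq> span (?T \<union> ?S)" by (rule span_minimal) (rule subspace_span)
  moreover have "span (fst ` ?A) = fst ` span ?A" by (rule linear_span_image) (rule linear_fst)
  moreover have "x \<in> fst ` span ?A" unfolding real_form[symmetric] by force
  ultimately have "x \<in> span (?T \<union> ?S)" by blast
  then obtain a b where "a \<in> span ?T" "b \<in> span ?S" "x = a + b" by (auto simp: span_Un)
  moreover have "span ?T = ?T" using subspace_ihR by (rule span_eq_iff[THEN iffD2])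
  ultimately show ?thesis using that by blast
qed

end

section \<open>The off-diagonal block of the representation\<close>

text \<open>The properties of a splitting \<open>W = V1 \<oplus> V2\<close>, with \<open>T\<close> for \<open>i \<hh>\<^sub>\<real>\<close> and \<open>S\<close> for the set of all \<open>X\<^sup>\<alpha>\<close>, \<open>Y\<^sup>\<alpha>\<close>.
Orthonormal bases of \<open>V1\<close> and \<open>V2\<close> are part of a basis \<open>B\<close> of the whole module, so the entries
\<open>\<xi> f (\<pi> x e)\<close> with \<open>e \<in> E1\<close> and \<open>f \<in> E2\<close> form the block \<open>V1 \<rightarrow> V2\<close> of \<open>\<pi> x\<close>.\<close>

locale splitting =
  fixes \<pi> :: "'u::real_vector \<Rightarrow> 'v::real_vector \<Rightarrow> 'v" and T S :: "'u set"
    and W V1 V2 E1 E2 :: "'v set" and ip :: "'v \<Rightarrow> 'v \<Rightarrow> real"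
    and B :: "'v set" and \<xi> :: "'v \<Rightarrow> 'v \<Rightarrow> real"
  assumes frame: "dual_frame B (\<lambda>b. b) \<xi>"
    and sub_W: "subspace W" and ip: "inner_product_on W ip"
    and sum: "direct_sum2 V1 V2 W"
    and bil: "bilinear \<pi>" and W_inv: "w \<in> W \<Longrightarrow> \<pi> x w \<in> W"
    and T_inv: "t \<in> T \<Longrightarrow> v \<in> V1 \<Longrightarrow> \<pi> t v \<in> V1"
    and S_swap: "s \<in> S \<Longrightarrow> v \<in> V1 \<Longrightarrow> \<pi> s v \<in> V2"
    and orth: "v \<in> V1 \<Longrightarrow> w \<in> V2 \<Longrightarrow> ip v w = 0"
    and S_nonzero: "s \<in> S \<Longrightarrow> \<exists>v\<in>V1. \<pi> s v \<noteq> 0"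
    and S_orth: "s \<in> S \<Longrightarrow> s' \<in> S \<Longrightarrow> s \<noteq> s' \<Longrightarrow>
      trace_on scaleR V1 (\<lambda>v. transpose_on ip V1 (\<pi> s') (\<pi> s v)) = 0"
    and E1: "orthonormal V1 ip E1" "span E1 = V1" and E2: "orthonormal V2 ip E2" "span E2 = V2"
    and EB: "E1 \<union> E2 \<subseteq> B"
begin

sublocale dual_frame B "\<lambda>b. b" \<xi> by (rule frame)

lemma sub_V1: "subspace V1" and sub_V2: "subspace V2" and V12: "V1 \<inter> V2 = {0}"
  using sum by (auto simp: direct_sum2_def)

lemmas V1_W = direct_sum2_subset(1)[OF sum] and V2_W = direct_sum2_subset(2)[OF sum]

lemma ip_V1: "inner_product_on V1 ip" and ip_V2: "inner_product_on V2 ip"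
  using inner_product_on_subset[OF ip] V1_W V2_W by auto

lemma E1_V1: "E1 \<subseteq> V1" and E2_V2: "E2 \<subseteq> V2" and fin_E1: "finite E1" and fin_E2: "finite E2"
  using E1 E2 by (auto simp: orthonormal_def)

lemma E_disjoint: "E1 \<inter> E2 = {}"
proof -
  have "0 \<notin> E1" using independent_orthonormal[OF sub_V1 ip_V1 E1(1)] dependent_zero by blast
  moreover have "x = 0" if "x \<in> E1" "x \<in> E2" for x
    using that E1_V1 E2_V2 V12 by auto
  ultimately show ?thesis by auto
qed

lemma coord_V1: "v \<in> V1 \<Longrightarrow> b \<in> B \<Longrightarrow> \<xi> b v = (if b \<in> E1 then ip v b else 0)"
proof -
  assume v: "v \<in> V1" and b: "b \<in> B"
  have "v = (\<Sum>c\<in>E1. ip v c *\<^sub>R c)"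
    using span_orthonormal_coords[OF sub_V1 ip_V1 E1(1)] v E1(2) by simp
  then have "\<xi> b v = \<xi> b (\<Sum>c\<in>E1. ip v c *\<^sub>R c)" by simp
  also have "\<dots> = (\<Sum>c\<in>E1. if c = b then ip v b else 0)"
    unfolding coord_sum[OF b] using EB b by (intro sum.cong refl) (auto simp: coord_scale dual subset_iff)
  finally show ?thesis by (simp add: fin_E1)
qed

lemma coord_V2: "v \<in> V2 \<Longrightarrow> b \<in> B \<Longrightarrow> \<xi> b v = (if b \<in> E2 then ip v b else 0)"
proof -
  assume v: "v \<in> V2" and b: "b \<in> B"
  have "v = (\<Sum>c\<in>E2. ip v c *\<^sub>R c)"
    using span_orthonormal_coords[OF sub_V2 ip_V2 E2(1)] v E2(2) by simp
  then have "\<xi> b v = \<xi> b (\<Sum>c\<in>E2. ip v c *\<^sub>R c)" by simp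
  also have "\<dots> = (\<Sum>c\<in>E2. if c = b then ip v b else 0)"
    unfolding coord_sum[OF b] using EB b by (intro sum.cong refl) (auto simp: coord_scale dual subset_iff)
  finally show ?thesis by (simp add: fin_E2)
qed

lemmas bs = bilinear_ladd[OF bil] bilinear_radd[OF bil] bilinear_lmul[OF bil] bilinear_rmul[OF bil]
  bilinear_lzero[OF bil] bilinear_rzero[OF bil]

lemma transpose_V1:
  "transpose_on ip V1 (\<pi> y) w = (\<Sum>e\<in>E1. ip w (\<pi> y e) *\<^sub>R e)" if w: "w \<in> W"
  unfolding transpose_on_def
proof (rule the_equality)
  let ?v = "\<Sum>e\<in>E1. ip w (\<pi> y e) *\<^sub>R e"
  have vV: "?v \<in> V1" using E1_V1 by (intro subspace_sum[OF sub_V1] subspace_scale[OF sub_V1]) auto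
  have ip_right: "ip a (p + q) = ip a p + ip a q" "ip a (c *\<^sub>R p) = c * ip a p"
    if "a \<in> W" "p \<in> W" "q \<in> W" for a p q c
    using ip_add[OF sub_W ip that(2,3,1)] ip_scale[OF sub_W ip that(2,1)] ip_commute[OF sub_W ip that(1)]
      that subspace_add[OF sub_W that(2,3)] subspace_scale[OF sub_W that(2)] by auto
  have "ip ?v s = ip w (\<pi> y s)" if s: "s \<in> V1" for s
  proof -
    have sW: "s \<in> W" using s V1_W by auto
    have "ip ?v s = (\<Sum>e\<in>E1. ip w (\<pi> y e) * ip e s)"
      using E1_V1 s fin_E1
      by (subst ip_sum[OF sub_V1 ip_V1]) (auto intro!: sum.cong subspace_scale[OF sub_V1] ip_scale[OF sub_V1 ip_V1])
    also have "\<dots> = (\<Sum>e\<in>E1. ip s e * ip w (\<pi> y e))"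
      using E1_V1 s by (intro sum.cong refl) (auto simp: ip_commute[OF sub_V1 ip_V1, of s])
    also have "\<dots> = ip w (\<Sum>e\<in>E1. ip s e *\<^sub>R \<pi> y e)"
    proof -
      have "finite A \<Longrightarrow> A \<subseteq> E1 \<Longrightarrow> (\<Sum>e\<in>A. ip s e * ip w (\<pi> y e)) = ip w (\<Sum>e\<in>A. ip s e *\<^sub>R \<pi> y e)" for A
      proof (induction A rule: finite_induct)
        case empty
        then show ?case using ip_right(2)[OF w subspace_0[OF sub_W] subspace_0[OF sub_W], of 0] by simp
      next
        case (insert e A)
        have "\<pi> y e' \<in> W" if "e' \<in> insert e A" for e'
          using that insert(4) E1_V1 V1_W by (intro W_inv) auto
        then have "\<pi> y e \<in> W" "(\<Sum>e\<in>A. ip s e *\<^sub>R \<pi> y e) \<in> W"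
          by (auto intro!: subspace_sum[OF sub_W] subspace_scale[OF sub_W])
        then show ?case using insert w by (simp add: ip_right subspace_scale[OF sub_W])
      qed
      from this[OF fin_E1 subset_refl] show ?thesis .
    qed
    also have "(\<Sum>e\<in>E1. ip s e *\<^sub>R \<pi> y e) = \<pi> y (\<Sum>e\<in>E1. ip s e *\<^sub>R e)"
      by (simp add: linear_sum[OF linear_bilinear_right[OF bil]] bs)
    also have "(\<Sum>e\<in>E1. ip s e *\<^sub>R e) = s"
      using span_orthonormal_coords[OF sub_V1 ip_V1 E1(1)] s E1(2) by simp
    finally show ?thesis .
  qed
  then show *: "?v \<in> V1 \<and> (\<forall>s\<in>V1. ip ?v s = ip w (\<pi> y s))" using vV by blast
  fix v assume v: "v \<in> V1 \<and> (\<forall>s\<in>V1. ip v s = ip w (\<pi> y s))"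
  have "\<xi> b v = \<xi> b ?v" if "b \<in> B" for b
    using v * that E1_V1 by (auto simp: coord_V1)
  then show "v = ?v" by (rule coord_ext)
qed

lemma trace_transpose:
  "trace_on scaleR V1 (\<lambda>v. transpose_on ip V1 (\<pi> y) (\<pi> x v)) = (\<Sum>e\<in>E1. ip (\<pi> x e) (\<pi> y e))"
proof -
  let ?f = "\<lambda>v. transpose_on ip V1 (\<pi> y) (\<pi> x v)"
  have W1: "v \<in> V1 \<Longrightarrow> \<pi> z v \<in> W" for z v using V1_W W_inv by blast
  have f: "?f v = (\<Sum>e\<in>E1. ip (\<pi> x v) (\<pi> y e) *\<^sub>R e)" if "v \<in> V1" for v
    by (rule transpose_V1[OF W1[OF that]])
  have fV: "?f v \<in> V1" if "v \<in> V1" for v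
    unfolding f[OF that] using E1_V1 by (intro subspace_sum[OF sub_V1] subspace_scale[OF sub_V1]) auto
  have E1W: "\<pi> y e \<in> W" if "e \<in> E1" for e using that E1_V1 W1 by blast
  have "trace_on scaleR V1 ?f = (\<Sum>e\<in>E1. \<xi> e (?f e))"
  proof (rule trace_on_part)
    show "?f (a + b) = ?f a + ?f b" if "a \<in> V1" "b \<in> V1" for a b
      unfolding f[OF that(1)] f[OF that(2)] f[OF subspace_add[OF sub_V1 that]]
      by (simp add: bs ip_add[OF sub_W ip] W1 that E1W scaleR_add_left sum.distrib)
    show "?f (c *\<^sub>R a) = c *\<^sub>R ?f a" if "a \<in> V1" for a c
      unfolding f[OF that(1)] f[OF subspace_scale[OF sub_V1 that]]
      by (simp add: bs ip_scale[OF sub_W ip] W1 that E1W scaleR_sum_right)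
  qed (use EB E1_V1 sub_V1 fV in \<open>auto simp: coord_V1\<close>)
  also have "\<dots> = (\<Sum>e\<in>E1. ip (\<pi> x e) (\<pi> y e))"
  proof (intro sum.cong refl)
    fix e assume e: "e \<in> E1"
    then have eV: "e \<in> V1" using E1_V1 by blast
    have "\<xi> e (?f e) = ip (?f e) e" using coord_V1[OF fV[OF eV], of e] e EB by auto
    also have "\<dots> = ip (\<pi> x e) (\<pi> y e)"
      unfolding f[OF eV] by (rule ip_sum_orthonormal[OF sub_V1 ip_V1 E1(1) e])
    finally show "\<xi> e (?f e) = ip (\<pi> x e) (\<pi> y e)" .
  qed
  finally show ?thesis .
qed

lemma off_diagonal_block_T: "t \<in> T \<Longrightarrow> e \<in> E1 \<Longrightarrow> f \<in> E2 \<Longrightarrow> \<xi> f (\<pi> t e) = 0"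
proof -
  assume a: "t \<in> T" "e \<in> E1" "f \<in> E2"
  then have "e \<in> V1" "f \<in> B" "f \<notin> E1" using E1_V1 EB E_disjoint by auto
  then show ?thesis using coord_V1[OF T_inv[OF a(1)], of e f] by simp
qed

text \<open>Elements of \<open>T\<close> preserve \<open>V1\<close> and do not contribute to the block, and elements of \<open>S\<close> map \<open>V1\<close> into \<open>V2\<close>,
so \<open>\<pi> r\<close> vanishes on \<open>V1\<close>. By the trace condition the restrictions \<open>\<pi> s\<close> to \<open>V1\<close>, for \<open>s \<in> S\<close>, are nonzero and
pairwise orthogonal for the Hilbert--Schmidt product, hence linearly independent; so all coefficients
of \<open>r\<close> vanish.\<close>

lemma off_diagonal_block_kernel:
  assumes r: "r \<in> span S" and t: "t \<in> T"
    and zero: "\<And>e f. e \<in> E1 \<Longrightarrow> f \<in> E2 \<Longrightarrow> \<xi> f (\<pi> (t + r) e) = 0"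
  shows "r = 0"
proof -
  obtain A a where A: "finite A" "A \<subseteq> S" "r = (\<Sum>s\<in>A. a s *\<^sub>R s)"
    using r unfolding span_explicit by auto
  have \<pi>r: "\<pi> r v = (\<Sum>s\<in>A. a s *\<^sub>R \<pi> s v)" for v
    unfolding A(3) by (simp add: linear_sum[OF linear_bilinear_left[OF bil]] bs)
  have re0: "\<pi> r e = 0" if e: "e \<in> E1" for e
  proof (rule coord_ext)
    have "\<pi> r e \<in> V2"
      unfolding \<pi>r using A(2) e E1_V1
      by (intro subspace_sum[OF sub_V2] subspace_scale[OF sub_V2] S_swap) auto
    moreover have "\<xi> b (\<pi> r e) = 0" if "b \<in> E2" for b
      using zero[OF e that] off_diagonal_block_T[OF t e that] that EB by (simp add: bs coord_add subset_iff)
    ultimately show "\<xi> b (\<pi> r e) = \<xi> b 0" if "b \<in> B" for b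
      using coord_V2[of "\<pi> r e" b] that by (auto simp: coord_zero)
  qed
  have \<pi>_W: "\<pi> s e \<in> W" if "e \<in> E1" for s e using that E1_V1 V1_W W_inv by blast
  have "a s = 0" if s: "s \<in> A" for s
  proof -
    have sS: "s \<in> S" using s A by auto
    have q0: "(\<Sum>e\<in>E1. ip (\<pi> s' e) (\<pi> s e)) = 0" if "s' \<in> A" "s' \<noteq> s" for s'
      using S_orth[of s' s] that A(2) sS trace_transpose[of s s'] by auto
    have "0 = (\<Sum>e\<in>E1. ip (\<pi> r e) (\<pi> s e))"
      by (simp add: re0 ip_zero[OF sub_W ip \<pi>_W])
    also have "\<dots> = (\<Sum>e\<in>E1. \<Sum>s'\<in>A. a s' * ip (\<pi> s' e) (\<pi> s e))"
    proof (intro sum.cong refl)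
      fix e assume e: "e \<in> E1"
      show "ip (\<pi> r e) (\<pi> s e) = (\<Sum>s'\<in>A. a s' * ip (\<pi> s' e) (\<pi> s e))"
        unfolding \<pi>r
        by (subst ip_sum[OF sub_W ip])
          (auto simp: A(1) \<pi>_W[OF e] subspace_scale[OF sub_W] ip_scale[OF sub_W ip])
    qed
    also have "\<dots> = (\<Sum>s'\<in>A. a s' * (\<Sum>e\<in>E1. ip (\<pi> s' e) (\<pi> s e)))"
      by (subst sum.swap) (simp add: sum_distrib_left)
    also have "\<dots> = (\<Sum>s'\<in>A. if s' = s then a s * (\<Sum>e\<in>E1. ip (\<pi> s e) (\<pi> s e)) else 0)"
      using q0 by (intro sum.cong refl) auto
    also have "\<dots> = a s * (\<Sum>e\<in>E1. ip (\<pi> s e) (\<pi> s e))"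
      using s A(1) by simp
    finally have "a s * (\<Sum>e\<in>E1. ip (\<pi> s e) (\<pi> s e)) = 0" by simp
    moreover have "(\<Sum>e\<in>E1. ip (\<pi> s e) (\<pi> s e)) > 0"
    proof -
      obtain v where v: "v \<in> V1" "\<pi> s v \<noteq> 0" using S_nonzero[OF sS] by blast
      obtain e where e: "e \<in> E1" "\<pi> s e \<noteq> 0"
      proof (rule ccontr)
        assume "\<not> thesis"
        then have "\<And>e. e \<in> E1 \<Longrightarrow> \<pi> s e = 0" using that by blast
        then have "\<pi> s v = 0"
          using linear_eq_0_on_span[OF linear_bilinear_right[OF bil, of s], of E1 v] v(1) E1(2) by auto
        then show False using v by simp
      qed
      have nn: "ip (\<pi> s e) (\<pi> s e) \<ge> 0" if "e \<in> E1" for e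
        using ip_pos[OF sub_W ip \<pi>_W[OF that], of s] ip_zero[OF sub_W ip subspace_0[OF sub_W]]
        by (cases "\<pi> s e = 0") auto
      show ?thesis
        using e nn by (intro sum_pos2[OF fin_E1 e(1)] ip_pos[OF sub_W ip \<pi>_W]) auto
    qed
    ultimately show ?thesis by simp
  qed
  then show ?thesis unfolding A(3) by simp
qed

end

section \<open>Negative Ricci curvature on the semidirect product\<close>

theorem theorem5p1:
  fixes br :: "'u::real_vector \<Rightarrow> 'u \<Rightarrow> 'u"
    and \<pi> :: "'u \<Rightarrow> 'v::real_vector \<Rightarrow> 'v"
    and h :: "('u \<times> 'u) set"
    and P :: "('u \<times> 'u \<Rightarrow> complex) set"
    and H X :: "('u \<times> 'u \<Rightarrow> complex) \<Rightarrow> 'u \<times> 'u"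
    and N :: "('u \<times> 'u \<Rightarrow> complex) \<Rightarrow> ('u \<times> 'u \<Rightarrow> complex) \<Rightarrow> real"
    and W :: "nat \<Rightarrow> 'v set"
    and k :: nat
    and c :: "nat \<Rightarrow> real"
    and D :: "'v \<Rightarrow> 'v"
  assumes "compact_semisimple br"
    and "cartan_subalgebra cscale (cbracket br) h"
    and "positive_system (croots br h) P"
    and "adapted_root_vectors br h H X N"
    and "lie_representation br \<pi>"
    and "fin_dim (scaleR :: real \<Rightarrow> 'v \<Rightarrow> 'v)"
    and "\<exists>v::'v. v \<noteq> 0"
    and "direct_sum_decomposition {1..k} W UNIV"
    and "\<forall>j\<in>{1..k}. submodule \<pi> (W j)"
    and "\<exists>i\<in>{1..k}. \<exists>V1 V2 ip.
           direct_sum2 V1 V2 (W i) \<and> inner_product_on (W i) ip \<and>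
           splitting_properties H X (croots br h) P \<pi> (W i) V1 V2 ip"
    and "\<forall>j\<in>{1..k}. c j > 0"
    and "linear D"
    and "\<forall>j\<in>{1..k}. \<forall>w\<in>W j. D w = c j *\<^sub>R w"
  shows "\<exists>ip. inner_product_on UNIV ip \<and> negative_ricci (semidirect_bracket br \<pi> D) ip"
proof -
  interpret compact_lie_algebra br by unfold_locales fact
  have bil_\<pi>: "bilinear \<pi>" and rep: "\<pi> (br x y) v = \<pi> x (\<pi> y v) - \<pi> y (\<pi> x v)" for x y v
    using assms(5) by (simp_all add: lie_representation_def)
  have lin_\<pi>: "linear (\<pi> x)" for x using bil_\<pi> by (simp add: bilinear_def)
  note \<pi>_simps = bilinear_ladd[OF bil_\<pi>] bilinear_radd[OF bil_\<pi>] bilinear_lmul[OF bil_\<pi>]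
    bilinear_rmul[OF bil_\<pi>]
  define T where "T = ihR H (croots br h)"
  define S where "S = Xu X ` P \<union> Yu X ` P"
  have sub_W: "subspace (W j)" and W_inv: "w \<in> W j \<Longrightarrow> \<pi> x w \<in> W j" if "j \<in> {1..k}" for j w x
    using assms(9) that unfolding submodule_def by blast+
  obtain i V1 V2 ip where i: "i \<in> {1..k}" and V: "direct_sum2 V1 V2 (W i)"
    and ip: "inner_product_on (W i) ip"
    and sp: "splitting_properties H X (croots br h) P \<pi> (W i) V1 V2 ip"
    using assms(10) by blast
  have sub_V: "subspace V1" "subspace V2" and W_sum: "W i = {v1 + v2 | v1 v2. v1 \<in> V1 \<and> v2 \<in> V2}"
    using V by (simp_all add: direct_sum2_def)
  note VW = direct_sum2_subset[OF V]
  note ipV = inner_product_on_subset[OF ip VW(1)] inner_product_on_subset[OF ip VW(2)]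
  have orth: "ip v w = 0" if "v \<in> V1" "w \<in> V2" for v w
    using sp that by (simp add: splitting_properties_def)

  obtain E1 where E1: "orthonormal V1 ip E1" "span E1 = V1"
    by (rule orthonormal_basis[OF assms(6) sub_V(1) ipV(1)])
  obtain E2 where E2: "orthonormal V2 ip E2" "span E2 = V2"
    by (rule orthonormal_basis[OF assms(6) sub_V(2) ipV(2)])
  have E12: "orthonormal (W i) ip (E1 \<union> E2)"
    by (rule orthonormal_Un[OF sub_W[OF i] ip VW E1(1) E2(1) orth])
  have E12_basis: "finite (E1 \<union> E2)" "\<not> dependent (E1 \<union> E2)" "span (E1 \<union> E2) = W i"
    using E12 independent_orthonormal[OF sub_W[OF i] ip E12] E1(2) E2(2) W_sum
    by (auto simp: orthonormal_def span_Un)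
  \<comment> \<open>Any basis will do in the submodules other than \<open>W i\<close>: their contribution to the block on
    \<open>\<uu>\<close> is nonpositive for every metric.\<close>
  have "\<forall>j\<in>{1..k}. \<exists>B. finite B \<and> \<not> dependent B \<and> span B = W j \<and> (j = i \<longrightarrow> B = E1 \<union> E2)"
  proof
    fix j assume j: "j \<in> {1..k}"
    obtain B where B: "finite B" "\<not> dependent B" "span B = W j"
      by (rule subspace_basis[OF assms(6) sub_W[OF j]])
    show "\<exists>B. finite B \<and> \<not> dependent B \<and> span B = W j \<and> (j = i \<longrightarrow> B = E1 \<union> E2)"
      using B E12_basis by (cases "j = i") blast+
  qed
  then obtain EE where EE: "\<And>j. j \<in> {1..k} \<Longrightarrow> finite (EE j)" "\<And>j. j \<in> {1..k} \<Longrightarrow> \<not> dependent (EE j)"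
    "\<And>j. j \<in> {1..k} \<Longrightarrow> span (EE j) = W j" "EE i = E1 \<union> E2"
    using i by (metis bchoice)
  define B where "B = (\<Union>j\<in>{1..k}. EE j)"
  have B: "finite B" "\<not> dependent B" "span B = UNIV"
    unfolding B_def using EE(1) direct_sum_basis[OF finite_atLeastAtMost assms(8) EE(1,2,3)] by auto
  define \<xi> where "\<xi> b v = representation B v b" for b v
  have frame: "dual_frame B (\<lambda>b. b) \<xi>"
    unfolding \<xi>_def by (rule dual_frame_basis[OF B])
  have EB: "E1 \<union> E2 \<subseteq> B" unfolding B_def using EE(4) i by blast

  interpret Sp: splitting \<pi> T S "W i" V1 V2 E1 E2 ip B \<xi>
  proof (rule splitting.intro)
    show "\<pi> x w \<in> W i" if "w \<in> W i" for x w by (rule W_inv[OF i that])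
    show "ip v w = 0" if "v \<in> V1" "w \<in> V2" for v w by (rule orth[OF that])
    note props = sp[unfolded splitting_properties_def, folded T_def S_def]
    note tail = props[THEN conjunct2, THEN conjunct2, THEN conjunct2, THEN conjunct2]
    show "\<pi> t v \<in> V1" if "t \<in> T" "v \<in> V1" for t v
      using props[THEN conjunct1] that by blast
    show "\<pi> s v \<in> V2" if "s \<in> S" "v \<in> V1" for s v
      using props[THEN conjunct2, THEN conjunct1] that unfolding S_def by blast
    show "\<exists>v\<in>V1. \<pi> s v \<noteq> 0" if "s \<in> S" for s
      using tail[THEN conjunct1] that unfolding S_def by blast
    show "trace_on scaleR V1 (\<lambda>v. transpose_on ip V1 (\<pi> s') (\<pi> s v)) = 0"
      if "s \<in> S" "s' \<in> S" "s \<noteq> s'" for s s'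
      by (rule tail[THEN conjunct2, rule_format]) (rule that)+
  qed (rule frame sub_W[OF i] ip V bil_\<pi> E1 E2 EB)+

  obtain I :: "'u set" and e \<xi>u where Ufr: "dual_frame I e \<xi>u" and metric:
    "\<And>x. x \<in> T \<Longrightarrow> x \<noteq> 0 \<Longrightarrow>
       (\<Sum>i\<in>I. \<Sum>j\<in>I. (dual_frame.frame_ip I \<xi>u (br (e i) (e j)) x)\<^sup>2)
       < (\<Sum>i\<in>I. \<Sum>j\<in>I. (\<xi>u j (br x (e i)) + \<xi>u i (br x (e j)))\<^sup>2)"
  proof (rule abelian_metric[of T])
    show "subspace T" unfolding T_def by (rule subspace_ihR)
    show "br x y = 0" if "x \<in> T" "y \<in> T" for x y
      using ihR_abelian[OF assms(1-4)] that unfolding T_def by blast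
  qed (rule that, assumption, blast)
  interpret U: dual_frame I e \<xi>u by (rule Ufr)

  \<comment> \<open>\<open>G\<close> is the part of the Ricci form on \<open>\<uu>\<close> that is independent of the stretching factor \<open>t\<close>, and \<open>Q\<close> is
    the squared norm of the block \<open>V1 \<rightarrow> V2\<close>; the last sum in \<open>G\<close> is the cross term of this block with
    the opposite one.\<close>
  define a where "a i j x = \<xi>u j (br x (e i)) + \<xi>u i (br x (e j))" for i j x
  define G where "G x y = (\<Sum>i\<in>I. \<Sum>j\<in>I. U.frame_ip (br (e i) (e j)) x * U.frame_ip (br (e i) (e j)) y) / 4
    - (\<Sum>i\<in>I. \<Sum>j\<in>I. a i j x * a i j y) / 4
    - (\<Sum>p\<in>E1. \<Sum>q\<in>E2. \<xi> q (\<pi> x p) * \<xi> p (\<pi> y q))" for x y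
  define Q where "Q x y = (\<Sum>p\<in>E1. \<Sum>q\<in>E2. \<xi> q (\<pi> x p) * \<xi> q (\<pi> y p))" for x y
  have lin_block: "linear (\<lambda>x. \<xi> q (\<pi> x p))" if "q \<in> B" for p q
    using that by (intro linearI) (simp_all add: \<pi>_simps Sp.coord_add Sp.coord_scale)
  have lin_a: "linear (a i j)" if "i \<in> I" "j \<in> I" for i j
    using that unfolding a_def
    by (intro linearI) (simp_all add: br_simps U.coord_add U.coord_scale algebra_simps)
  have lin_frame_ip: "linear (U.frame_ip x)" for x using U.bilinear_frame_ip by (simp add: bilinear_def)
  have bil_G: "bilinear G"
    unfolding G_def using EB
    by (intro bilinear_diff_fun bilinear_divide_fun bilinear_sum_fun bilinear_product lin_frame_ip lin_a lin_block) auto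
  have bil_Q: "bilinear Q"
    unfolding Q_def using EB by (intro bilinear_sum_fun bilinear_product lin_block) auto
  have neg: "G x x < 0" if x: "x \<noteq> 0" "Q x x = 0" for x
  proof -
    have zero: "\<xi> q (\<pi> x p) = 0" if "p \<in> E1" "q \<in> E2" for p q
      by (rule sum_sum_squares_zero[where c = "\<lambda>q p. \<xi> q (\<pi> x p)", OF Sp.fin_E1 Sp.fin_E2 x(2)[unfolded Q_def] that])
    obtain t r where tr: "t \<in> T" "r \<in> span S" "x = t + r"
  by (rule real_form_decomposition[OF assms(1-4), folded T_def S_def])
    have "r = 0" by (rule Sp.off_diagonal_block_kernel[OF tr(2,1)]) (simp add: zero flip: tr(3))
    then have "x \<in> T" using tr by simp
    then show ?thesis
      using metric[OF _ x(1)] zero by (simp add: G_def a_def power2_eq_square)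
  qed
  obtain l where l: "\<And>t x. t \<ge> l \<Longrightarrow> x \<noteq> 0 \<Longrightarrow> G x x - t * Q x x < 0"
  proof (rule negative_definite_after_penalty[OF fin_dim bil_G bil_Q])
    show "Q x y = Q y x" for x y by (simp add: Q_def mult.commute)
    show "Q x x \<ge> 0" for x by (auto simp: Q_def intro!: sum_nonneg)
  qed (use neg in auto)
  \<comment> \<open>Then \<open>t\<^sup>2 \<ge> t \<ge> 2 l\<close>.\<close>
  define t where "t = 1 + 2 * \<bar>l\<bar>"
  have t: "t > 0" "t\<^sup>2 / 2 \<ge> l"
  proof -
    have "t * 1 \<le> t * t" by (intro mult_left_mono) (auto simp: t_def)
    then show "t\<^sup>2 / 2 \<ge> l" by (simp add: t_def power2_eq_square)
  qed (simp add: t_def)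

  \<comment> \<open>The basis vectors in \<open>E2\<close> are divided by \<open>t\<close>, which stretches \<open>V2\<close> by \<open>t\<close>.\<close>
  define s where "s b = (if b \<in> E2 then t else 1)" for b
  have s0: "s b \<noteq> 0" for b using t by (simp add: s_def)
  have Vfr: "dual_frame B (\<lambda>b. (1 / s b) *\<^sub>R b) (\<lambda>b v. s b * \<xi> b v)"
    by (rule dual_frame_scale[OF frame s0])
  \<comment> \<open>A basis vector lies in exactly one \<open>EE j\<close>, and \<open>D\<close> acts on it by \<open>c j\<close>.\<close>
  define \<gamma> where "\<gamma> b = c (SOME j. j \<in> {1..k} \<and> b \<in> EE j)" for b
  have \<gamma>: "\<gamma> b > 0" "D b = \<gamma> b *\<^sub>R b" if "b \<in> B" for b
  proof -
    define j where "j = (SOME j. j \<in> {1..k} \<and> b \<in> EE j)"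
    have "\<exists>j. j \<in> {1..k} \<and> b \<in> EE j" using that by (auto simp: B_def)
    then have j: "j \<in> {1..k} \<and> b \<in> EE j" unfolding j_def by (rule someI_ex)
    then have "b \<in> W j" using EE(3)[of j] span_base[of b "EE j"] by auto
    then show "\<gamma> b > 0" "D b = \<gamma> b *\<^sub>R b"
      using j assms(11,13) unfolding \<gamma>_def j_def[symmetric] by auto
  qed
  have comm: "D (\<pi> x v) = \<pi> x (D v)" for x v
  proof -
    have l: "linear (\<lambda>v. D (\<pi> x v))" "linear (\<lambda>v. \<pi> x (D v))"
      using linear_compose[OF lin_\<pi> assms(12)] linear_compose[OF assms(12) lin_\<pi>]
      by (simp_all add: o_def)
    show ?thesis
    proof (rule linear_eq_on_span[OF l, of B])
      fix b assume "b \<in> B"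
      then obtain j where j: "j \<in> {1..k}" "b \<in> EE j" by (auto simp: B_def)
      then have "b \<in> W j" using EE(3)[of j] span_base[of b "EE j"] by auto
      then show "D (\<pi> x b) = \<pi> x (D b)"
        using assms(13) j W_inv[OF j(1)] by (simp add: \<pi>_simps)
    qed (use B in auto)
  qed
  interpret F: semidirect_frames I e \<xi>u B "\<lambda>b. (1 / s b) *\<^sub>R b" "\<lambda>b v. s b * \<xi> b v" br \<pi> D \<gamma>
    by (intro semidirect_frames.intro Ufr Vfr semidirect_frames_axioms.intro bil br_anti bil_\<pi> assms(12))
      (simp add: linear_scale[OF assms(12)] \<gamma>)
  \<comment> \<open>Each of the three traces is linear in \<open>x\<close> and, on a bracket, the trace of a commutator.\<close>
  have tr1: "U.frame_trace (br x) = 0" for x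
  proof (rule linear_vanishes[of "\<lambda>x. U.frame_trace (br x)"])
    show "linear (\<lambda>x. U.frame_trace (br x))" by (rule U.linear_frame_trace[OF bil])
    show "U.frame_trace (br (br x y)) = 0" for x y
    proof -
      have "br (br x y) = (\<lambda>z. br x (br y z) - br y (br x z))" by (rule ext) (rule br_br)
      then show ?thesis
        using U.frame_trace_commute[OF linear_br[of x] linear_br[of y]] by (simp add: U.frame_trace_diff)
    qed
  qed
  have tr2: "F.V.frame_trace (\<pi> x) = 0" for x
  proof (rule linear_vanishes[of "\<lambda>x. F.V.frame_trace (\<pi> x)"])
    show "linear (\<lambda>x. F.V.frame_trace (\<pi> x))" by (rule F.V.linear_frame_trace[OF bil_\<pi>])
    show "F.V.frame_trace (\<pi> (br x y)) = 0" for x y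
    proof -
      have "\<pi> (br x y) = (\<lambda>v. \<pi> x (\<pi> y v) - \<pi> y (\<pi> x v))" by (rule ext) (rule rep)
      then show ?thesis
        using F.V.frame_trace_commute[OF lin_\<pi>[of x] lin_\<pi>[of y]] by (simp add: F.V.frame_trace_diff)
    qed
  qed
  have tr3: "F.V.frame_trace (\<lambda>w. D (\<pi> x w)) = 0" for x
  proof (rule linear_vanishes[of "\<lambda>x. F.V.frame_trace (\<lambda>w. D (\<pi> x w))"])
    have lin_D\<pi>: "linear (\<lambda>w. D (\<pi> x w))" for x
      using linear_compose[OF lin_\<pi> assms(12)] by (simp add: o_def)
    have "bilinear (\<lambda>x w. D (\<pi> x w))"
      unfolding bilinear_def
      by (intro conjI allI lin_D\<pi> linearI)
        (simp_all add: \<pi>_simps linear_add[OF assms(12)] linear_scale[OF assms(12)])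
    then show "linear (\<lambda>x. F.V.frame_trace (\<lambda>w. D (\<pi> x w)))" by (rule F.V.linear_frame_trace)
    show "F.V.frame_trace (\<lambda>w. D (\<pi> (br x y) w)) = 0" for x y
      using F.V.frame_trace_commute[OF lin_D\<pi>[of x] lin_\<pi>[of y]]
      by (simp add: rep linear_diff[OF assms(12)] F.V.frame_trace_diff comm)
  qed
  show ?thesis
  proof (rule F.negative_ricci_after_scaling[OF tr1 tr2 tr3])
    show "B \<noteq> {}" using B(3) assms(7) by auto
    show "\<gamma> b > 0" if "b \<in> B" for b by (rule \<gamma>(1)[OF that])
    fix x :: 'u assume x: "x \<noteq> 0"
    define A where "A p q = s q * \<xi> q (\<pi> x ((1 / s p) *\<^sub>R p)) + s p * \<xi> p (\<pi> x ((1 / s q) *\<^sub>R q))" for p q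
    \<comment> \<open>Symmetrised, the stretched block has entries \<open>t u + w / t\<close> with \<open>u\<close>, \<open>w\<close> opposite entries;
      their squares exceed \<open>t\<^sup>2 u\<^sup>2 + 2 u w\<close>.\<close>
    have A_ge: "(A p q)\<^sup>2 \<ge> t\<^sup>2 * (\<xi> q (\<pi> x p) * \<xi> q (\<pi> x p)) + 2 * (\<xi> q (\<pi> x p) * \<xi> p (\<pi> x q))"
      if "p \<in> E1" "q \<in> E2" for p q
    proof -
      have "p \<notin> E2" "p \<in> B" "q \<in> B" using that Sp.E_disjoint EB by auto
      then have "A p q = t * \<xi> q (\<pi> x p) + \<xi> p (\<pi> x q) / t"
        using that(2) by (simp add: A_def s_def \<pi>_simps Sp.coord_scale)
      moreover have "(t * u + w / t)\<^sup>2 = t\<^sup>2 * (u * u) + 2 * (u * w) + (w / t)\<^sup>2" for u w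
        using t(1) by (simp add: power2_eq_square field_simps)
      ultimately show ?thesis by simp
    qed
    have "2 * (\<Sum>p\<in>E1. \<Sum>q\<in>E2. (A p q)\<^sup>2) \<le> (\<Sum>p\<in>B. \<Sum>q\<in>B. (A p q)\<^sup>2)"
      using EB Sp.E_disjoint by (intro sum_off_diagonal_blocks B) (auto simp: A_def add.commute)
    moreover have "t\<^sup>2 * Q x x + 2 * (\<Sum>p\<in>E1. \<Sum>q\<in>E2. \<xi> q (\<pi> x p) * \<xi> p (\<pi> x q))
        \<le> (\<Sum>p\<in>E1. \<Sum>q\<in>E2. (A p q)\<^sup>2)"
      unfolding Q_def sum_distrib_left sum.distrib[symmetric] by (intro sum_mono A_ge)
    moreover have "G x x - t\<^sup>2 / 2 * Q x x < 0" by (rule l[OF t(2) x])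
    ultimately show "(\<Sum>i\<in>I. \<Sum>j\<in>I. (U.frame_ip (br (e i) (e j)) x)\<^sup>2) / 4
        - (\<Sum>i\<in>I. \<Sum>j\<in>I. (\<xi>u j (br x (e i)) + \<xi>u i (br x (e j)))\<^sup>2) / 4
        - (\<Sum>p\<in>B. \<Sum>q\<in>B. (s q * \<xi> q (\<pi> x ((1 / s p) *\<^sub>R p)) + s p * \<xi> p (\<pi> x ((1 / s q) *\<^sub>R q)))\<^sup>2) / 4 < 0"
      unfolding A_def[symmetric] a_def[symmetric] G_def power2_eq_square by argo
  qed
qed

end
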